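(* Let $\mathbf{A}_1\in\mathbb{H}^{m\times n}_{r_1}$, $\mathbf{B}_1\in\mathbb{H}^{r\times s}_{r_2}$, $\mathbf{A}_2\in\mathbb{H}^{m\times p}_{r_3}$, $\mathbf{B}_2\in\mathbb{H}^{q\times s}_{r_4}$ and $\mathbf{C}\in\mathbb{H}^{m\times s}$. Put $\mathbf{M}=\mathbf{R}_{A_1}\mathbf{A}_2$, $\mathbf{N}=\mathbf{B}_2\mathbf{L}_{B_1}$, $\mathbf{S}=\mathbf{A}_2\mathbf{L}_M$, and let $\operatorname{rank}\mathbf{M}=r_5$, $\operatorname{rank}\mathbf{N}=r_6$, $\operatorname{rank}\mathbf{S}=r_7$. Consider the pair $$\mathbf{X}_1=\mathbf{A}_1^\dagger\mathbf{C}\mathbf{B}_1^\dagger-\mathbf{A}_1^\dagger\mathbf{A}_2\mathbf{M}^\dagger\mathbf{C}\mathbf{B}_1^\dagger-\mathbf{A}_1^\dagger\mathbf{S}\mathbf{A}_2^\dagger\mathbf{C}\mathbf{N}^\dagger\mathbf{B}_2\mathbf{B}_1^\dagger=(x^{(1)}_{ij})\in\mathbb{H}^{n\times r},\qquad \mathbf{X}_2=\mathbf{M}^\dagger\mathbf{C}\mathbf{B}_2^\dagger+\mathbf{P}_S\mathbf{A}_2^\dagger\mathbf{C}\mathbf{N}^\dagger=(x^{(2)}_{gf})\in\mathbb{H}^{p\times q}$$ (a partial solution of $\mathbf{A}_1\mathbf{X}_1\mathbf{B}_1+\mathbf{A}_2\mathbf{X}_2\mathbf{B}_2=\mathbf{C}$).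 Define the auxiliary matrices $\mathbf{C}_1=\mathbf{A}_1^*\mathbf{C}\mathbf{B}_1^*$, $\tilde{\mathbf{A}}_2=\mathbf{A}_1^*\mathbf{A}_2$ (with columns $\tilde{\mathbf{a}}^{(2)}_{.t}$), $\mathbf{C}_2=\mathbf{M}^*\mathbf{C}\mathbf{B}_1^*$, $\tilde{\mathbf{S}}=\mathbf{A}_1^*\mathbf{S}$ (columns $\tilde{\mathbf{s}}_{.t}$), $\tilde{\mathbf{B}}_2=\mathbf{B}_2\mathbf{B}_1^*$ (rows $\tilde{\mathbf{b}}^{(2)}_{f.}$), $\mathbf{C}_3=\mathbf{A}_2^*\mathbf{C}\mathbf{N}^*$, $\mathbf{C}_4=\mathbf{M}^*\mathbf{C}\mathbf{B}_2^*$, and let $\ddot{\mathbf{s}}_{.t}$ be the $t$th column of $\mathbf{S}^*\mathbf{S}$; for each $\mathbf{C}_\nu$ write $\mathbf{c}^{(\nu)}_{k.}$ and $\mathbf{c}^{(\nu)}_{.l}$ for its $k$th row and $l$th column. Then $$x^{(1)}_{ij}=x^{(11)}_{ij}-x^{(12)}_{ij}-x^{(13)}_{ij},\qquad x^{(2)}_{gf}=x^{(21)}_{gf}+x^{(22)}_{gf},$$ where: (1) $x^{(11)}_{ij}=\dfrac{\sum_{\beta\in J_{r_1,n}\{i\}}\mathrm{cdet}_i\big((\mathbf{A}_1^*\mathbf{A}_1)_{.i}(\mathbf{d}^{B_1}_{.j})\big)^\beta_\beta}{\sum_{\beta\in J_{r_1,n}}|\mathbf{A}_1^*\mathbf{A}_1|^\beta_\beta\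 \sum_{\alpha\in I_{r_2,r}}|\mathbf{B}_1\mathbf{B}_1^*|^\alpha_\alpha}=\dfrac{\sum_{\alpha\in I_{r_2,r}\{j\}}\mathrm{rdet}_j\big((\mathbf{B}_1\mathbf{B}_1^* )_{j.}(\mathbf{d}^{A_1}_{i.})\big)^\alpha_\alpha}{\sum_{\beta\in J_{r_1,n}}|\mathbf{A}_1^*\mathbf{A}_1|^\beta_\beta\ \sum_{\alpha\in I_{r_2,r}}|\mathbf{B}_1\mathbf{B}_1^*|^\alpha_\alpha}$, where $\mathbf{d}^{B_1}_{.j}\in\mathbb{H}^{n\times1}$ has $k$th entry $\sum_{\alpha\in I_{r_2,r}\{j\}}\mathrm{rdet}_j\big((\mathbf{B}_1\mathbf{B}_1^* )_{j.}(\mathbf{c}^{(1)}_{k.})\big)^\alpha_\alpha$ ($k=1,\dots,n$) and $\mathbf{d}^{A_1}_{i.}\in\mathbb{H}^{1\times r}$ has $l$th entry $\sum_{\beta\in J_{r_1,n}\{i\}}\mathrm{cdet}_i\big((\mathbf{A}_1^*\mathbf{A}_1)_{.i}(\mathbf{c}^{(1)}_{.l})\big)^\beta_\beta$ ($l=1,\dots,r$); (2) $x^{(12)}_{ij}=\dfrac{\sum_{t=1}^p\sum_{\beta\in J_{r_1,n}\{i\}}\mathrm{cdet}_i\big((\mathbf{A}_1^*\mathbf{A}_1)_{.i}(\tilde{\mathbf{a}}^{(2)}_{.t})\big)^\beta_\beta\,\varphi_{tj}}{\sum_{\beta\in J_{r_1,n}}|\mathbf{A}_1^*\mathbf{A}_1|^\beta_\beta\sum_{\beta\in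 J_{r_5,p}}|\mathbf{M}^*\mathbf{M}|^\beta_\beta\sum_{\alpha\in I_{r_2,r}}|\mathbf{B}_1\mathbf{B}_1^*|^\alpha_\alpha}$, where $\varphi_{tj}=\sum_{\beta\in J_{r_5,p}\{t\}}\mathrm{cdet}_t\big((\mathbf{M}^*\mathbf{M})_{.t}(\boldsymbol{\psi}^{B_1}_{.j})\big)^\beta_\beta=\sum_{\alpha\in I_{r_2,r}\{j\}}\mathrm{rdet}_j\big((\mathbf{B}_1\mathbf{B}_1^* )_{j.}(\boldsymbol{\psi}^{M}_{t.})\big)^\alpha_\alpha$, with $\boldsymbol{\psi}^{B_1}_{.j}\in\mathbb{H}^{p\times1}$ having $k$th entry $\sum_{\alpha\in I_{r_2,r}\{j\}}\mathrm{rdet}_j\big((\mathbf{B}_1\mathbf{B}_1^* )_{j.}(\mathbf{c}^{(2)}_{k.})\big)^\alpha_\alpha$ ($k=1,\dots,p$) and $\boldsymbol{\psi}^{M}_{t.}\in\mathbb{H}^{1\times r}$ having $l$th entry $\sum_{\beta\in J_{r_5,p}\{t\}}\mathrm{cdet}_t\big((\mathbf{M}^*\mathbf{M})_{.t}(\mathbf{c}^{(2)}_{.l})\big)^\beta_\beta$ ($l=1,\dots,r$); (3) $x^{(13)}_{ij}=\dfrac{\sum_{t=1}^p\sum_{f=1}^q\Big(\sum_{\beta\in J_{r_1,n}\{i\}}\mathrm{cdet}_i\big((\mathbf{A}_1^*\mathbf{A}_1)_{.i}(\tilde{\mathbf{s}}_{.t})\big)^\beta_\beta\Big)\,\eta_{tf}\,\Big(\sum_{\alpha\in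 I_{r_2,r}\{j\}}\mathrm{rdet}_j\big((\mathbf{B}_1\mathbf{B}_1^* )_{j.}(\tilde{\mathbf{b}}^{(2)}_{f.})\big)^\alpha_\alpha\Big)}{\sum_{\beta\in J_{r_1,n}}|\mathbf{A}_1^*\mathbf{A}_1|^\beta_\beta\sum_{\beta\in J_{r_3,p}}|\mathbf{A}_2^*\mathbf{A}_2|^\beta_\beta\sum_{\alpha\in I_{r_6,q}}|\mathbf{N}\mathbf{N}^*|^\alpha_\alpha\sum_{\alpha\in I_{r_2,r}}|\mathbf{B}_1\mathbf{B}_1^*|^\alpha_\alpha}$, where $\eta_{tf}=\sum_{\beta\in J_{r_3,p}\{t\}}\mathrm{cdet}_t\big((\mathbf{A}_2^*\mathbf{A}_2)_{.t}(\boldsymbol{\zeta}^{N}_{.f})\big)^\beta_\beta=\sum_{\alpha\in I_{r_6,q}\{f\}}\mathrm{rdet}_f\big((\mathbf{N}\mathbf{N}^* )_{f.}(\boldsymbol{\zeta}^{A_2}_{t.})\big)^\alpha_\alpha$, with $\boldsymbol{\zeta}^{N}_{.f}\in\mathbb{H}^{p\times1}$ having $k$th entry $\sum_{\alpha\in I_{r_6,q}\{f\}}\mathrm{rdet}_f\big((\mathbf{N}\mathbf{N}^* )_{f.}(\mathbf{c}^{(3)}_{k.})\big)^\alpha_\alpha$ ($k=1,\dots,p$) and $\boldsymbol{\zeta}^{A_2}_{t.}\in\mathbb{H}^{1\times q}$ having $l$th entry $\sum_{\beta\in J_{r_3,p}\{t\}}\mathrm{cdet}_t\big((\mathbf{A}_2^*\mathbf{A}_2)_{.t}(\mathbf{c}^{(3)}_{.l})\big)^\beta_\beta$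 ($l=1,\dots,q$); (4) $x^{(21)}_{gf}=\dfrac{\sum_{\beta\in J_{r_5,p}\{g\}}\mathrm{cdet}_g\big((\mathbf{M}^*\mathbf{M})_{.g}(\mathbf{d}^{B_2}_{.f})\big)^\beta_\beta}{\sum_{\beta\in J_{r_5,p}}|\mathbf{M}^*\mathbf{M}|^\beta_\beta\sum_{\alpha\in I_{r_4,q}}|\mathbf{B}_2\mathbf{B}_2^*|^\alpha_\alpha}=\dfrac{\sum_{\alpha\in I_{r_4,q}\{f\}}\mathrm{rdet}_f\big((\mathbf{B}_2\mathbf{B}_2^* )_{f.}(\mathbf{d}^{M}_{g.})\big)^\alpha_\alpha}{\sum_{\beta\in J_{r_5,p}}|\mathbf{M}^*\mathbf{M}|^\beta_\beta\sum_{\alpha\in I_{r_4,q}}|\mathbf{B}_2\mathbf{B}_2^*|^\alpha_\alpha}$, where $\mathbf{d}^{B_2}_{.f}\in\mathbb{H}^{p\times1}$ has $k$th entry $\sum_{\alpha\in I_{r_4,q}\{f\}}\mathrm{rdet}_f\big((\mathbf{B}_2\mathbf{B}_2^* )_{f.}(\mathbf{c}^{(4)}_{k.})\big)^\alpha_\alpha$ ($k=1,\dots,p$) and $\mathbf{d}^{M}_{g.}\in\mathbb{H}^{1\times q}$ has $l$th entry $\sum_{\beta\in J_{r_5,p}\{g\}}\mathrm{cdet}_g\big((\mathbf{M}^*\mathbf{M})_{.g}(\mathbf{c}^{(4)}_{.l})\big)^\beta_\beta$ ($l=1,\dots,q$); (5) $x^{(22)}_{gf}=\dfrac{\sum_{t=1}^p\sum_{\beta\in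 J_{r_7,p}\{g\}}\mathrm{cdet}_g\big((\mathbf{S}^*\mathbf{S})_{.g}(\ddot{\mathbf{s}}_{.t})\big)^\beta_\beta\,\eta_{tf}}{\sum_{\beta\in J_{r_7,p}}|\mathbf{S}^*\mathbf{S}|^\beta_\beta\sum_{\beta\in J_{r_3,p}}|\mathbf{A}_2^*\mathbf{A}_2|^\beta_\beta\sum_{\alpha\in I_{r_6,q}}|\mathbf{N}\mathbf{N}^*|^\alpha_\alpha}$, with $\eta_{tf}$ as in (3).
   Context: $\mathbb{H}$ is the skew field of real quaternions; $\mathbb{H}^{m\times n}$ is the set of $m\times n$ matrices over $\mathbb{H}$ and $\mathbb{H}^{m\times n}_r$ the subset of those of rank $r$. $\mathbf{A}^*$ is the conjugate transpose and $\mathbf{A}^\dagger$ the Moore–Penrose inverse (the unique $\mathbf{X}$ with $\mathbf{AXA}=\mathbf{A}$, $\mathbf{XAX}=\mathbf{X}$, $(\mathbf{AX})^*=\mathbf{AX}$, $(\mathbf{XA})^*=\mathbf{XA}$). $\mathbf{L}_A=\mathbf{I}-\mathbf{A}^\dagger\mathbf{A}$, $\mathbf{R}_A=\mathbf{I}-\mathbf{A}\mathbf{A}^\dagger$, $\mathbf{P}_A=\mathbf{A}^\dagger\mathbf{A}$, $\mathbf{Q}_A=\mathbf{A}\mathbf{A}^\dagger$. For a matrix $\mathbf{F}$, $\mathbf{F}_{.j}(\mathbf{b})$ (resp. $\mathbf{F}_{i.}(\mathbf{b})$) is $\mathbf{F}$ with its $j$th column (resp. $i$th row) replaced by the column (resp.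 row) $\mathbf{b}$. Row/column determinants: for $\mathbf{F}=(a_{ij})\in\mathbb{H}^{n\times n}$, $\mathrm{rdet}_i\mathbf{F}=\sum_{\sigma\in S_n}(-1)^{n-r}(a_{i\,i_{k_1}}a_{i_{k_1}i_{k_1+1}}\cdots a_{i_{k_1+l_1}i})\cdots(a_{i_{k_r}i_{k_r+1}}\cdots a_{i_{k_r+l_r}i_{k_r}})$, where $\sigma=(i\,i_{k_1}\,i_{k_1+1}\cdots i_{k_1+l_1})(i_{k_2}\cdots i_{k_2+l_2})\cdots(i_{k_r}\cdots i_{k_r+l_r})$ is the decomposition of $\sigma$ into $r$ disjoint cycles (fixed points included) with $i_{k_2}<\cdots<i_{k_r}$ and $i_{k_t}<i_{k_t+s}$ for $t=2,\dots,r$, $s=1,\dots,l_t$; and $\mathrm{cdet}_j\mathbf{F}=\sum_{\tau\in S_n}(-1)^{n-r}(a_{j_{k_r}j_{k_r+l_r}}\cdots a_{j_{k_r+1}j_{k_r}})\cdots(a_{j\,j_{k_1+l_1}}\cdots a_{j_{k_1+1}j_{k_1}}a_{j_{k_1}j})$, where $\tau=(j_{k_r+l_r}\cdots j_{k_r+1}\,j_{k_r})\cdots(j_{k_2+l_2}\cdots j_{k_2})(j_{k_1+l_1}\cdots j_{k_1+1}\,j_{k_1}\,j)$ is the decomposition into $r$ disjoint cycles with $j_{k_2}<\cdots<j_{k_r}$ and $j_{k_t}<j_{k_t+s}$ for $t=2,\dots,r$, $s=1,\dots,l_t$. For Hermitian $\mathbf{F}$ all these coincide and are real; this value is $\det\mathbf{F}$.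 Index sets: $L_{k,n}$ is the set of strictly increasing sequences $\alpha=(\alpha_1<\cdots<\alpha_k)$ in $\{1,\dots,n\}$; $I_{k,m}\{i\}=\{\alpha\in L_{k,m}: i\in\alpha\}$, $J_{k,n}\{j\}=\{\beta\in L_{k,n}: j\in\beta\}$; sums over $J_{k,n}$ or $I_{k,m}$ without braces run over all of $L_{k,n}$, $L_{k,m}$. For a square $\mathbf{F}$, $\mathbf{F}^\alpha_\alpha$ is the principal submatrix with rows and columns indexed by $\alpha$; $\mathrm{cdet}_i(\mathbf{G})^\beta_\beta$ (resp. $\mathrm{rdet}_j(\mathbf{G})^\alpha_\alpha$) is the column (resp. row) determinant of the principal submatrix $\mathbf{G}^\beta_\beta$ taken at the column (resp. row) coming from index $i$ (resp. $j$); for Hermitian $\mathbf{F}$, $|\mathbf{F}|^\alpha_\alpha=\det\mathbf{F}^\alpha_\alpha$. *)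

theory Defs
  imports "Jordan_Normal_Form.Matrix" "HOL-Combinatorics.Permutations"
begin

datatype quat = Quat (qre: real) (qi: real) (qj: real) (qk: real)

lemma quat_eq_iff: "x = y \<longleftrightarrow> qre x = qre y \<and> qi x = qi y \<and> qj x = qj y \<and> qk x = qk y"
  by (cases x; cases y) auto

instantiation quat :: "{zero, one, plus, minus, uminus, times, inverse}"
begin
definition "0 = Quat 0 0 0 0"
definition "1 = Quat 1 0 0 0"
definition "x + y = Quat (qre x + qre y) (qi x + qi y) (qj x + qj y) (qk x + qk y)"
definition "x - y = Quat (qre x - qre y) (qi x - qi y) (qj x - qj y) (qk x - qk y)"
definition "- x = Quat (- qre x) (- qi x) (- qj x) (- qk x)"
definition "x * y = Quat
   (qre x * qre y - qi x * qi y - qj x * qj y - qk x * qk y)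
   (qre x * qi y + qi x * qre y + qj x * qk y - qk x * qj y)
   (qre x * qj y - qi x * qk y + qj x * qre y + qk x * qi y)
   (qre x * qk y + qi x * qj y - qj x * qi y + qk x * qre y)"
definition "inverse x = (let d = (qre x)\<^sup>2 + (qi x)\<^sup>2 + (qj x)\<^sup>2 + (qk x)\<^sup>2 in
   Quat (qre x / d) (- qi x / d) (- qj x / d) (- qk x / d))"
definition "x div (y::quat) = x * inverse y"
instance ..
end

lemma quat_sel [simp]:
  "qre 0 = 0" "qi 0 = 0" "qj 0 = 0" "qk 0 = 0"
  "qre 1 = 1" "qi 1 = 0" "qj 1 = 0" "qk 1 = 0"
  "qre (x + y) = qre x + qre y" "qi (x + y) = qi x + qi y"
  "qj (x + y) = qj x + qj y" "qk (x + y) = qk x + qk y"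
  "qre (x - y) = qre x - qre y" "qi (x - y) = qi x - qi y"
  "qj (x - y) = qj x - qj y" "qk (x - y) = qk x - qk y"
  "qre (- x) = - qre x" "qi (- x) = - qi x" "qj (- x) = - qj x" "qk (- x) = - qk x"
  "qre (x * y) = qre x * qre y - qi x * qi y - qj x * qj y - qk x * qk y"
  "qi (x * y) = qre x * qi y + qi x * qre y + qj x * qk y - qk x * qj y"
  "qj (x * y) = qre x * qj y - qi x * qk y + qj x * qre y + qk x * qi y"
  "qk (x * y) = qre x * qk y + qi x * qj y - qj x * qi y + qk x * qre y"
  by (simp_all add: zero_quat_def one_quat_def plus_quat_def minus_quat_def
      uminus_quat_def times_quat_def)

instance quat :: ring_1
  by standard (simp_all add: quat_eq_iff algebra_simps)

definition qcnj :: "quat \<Rightarrow> quat" where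
  "qcnj x = Quat (qre x) (- qi x) (- qj x) (- qk x)"

definition ctr :: "quat mat \<Rightarrow> quat mat" where
  "ctr A = mat (dim_col A) (dim_row A) (\<lambda>(i, j). qcnj (A $$ (j, i)))"

definition mpinv :: "quat mat \<Rightarrow> quat mat" where
  "mpinv A = (THE X. X \<in> carrier_mat (dim_col A) (dim_row A) \<and>
     A * X * A = A \<and> X * A * X = X \<and> ctr (A * X) = A * X \<and> ctr (X * A) = X * A)"

definition LL :: "quat mat \<Rightarrow> quat mat" where
  "LL A = 1\<^sub>m (dim_col A) - mpinv A * A"
definition RR :: "quat mat \<Rightarrow> quat mat" where
  "RR A = 1\<^sub>m (dim_row A) - A * mpinv A"
definition PP :: "quat mat \<Rightarrow> quat mat" where
  "PP A = mpinv A * A"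

definition right_indep_cols :: "quat mat \<Rightarrow> nat set \<Rightarrow> bool" where
  "right_indep_cols A J = (\<forall>x :: nat \<Rightarrow> quat.
     (\<forall>a < dim_row A. (\<Sum>j\<in>J. A $$ (a, j) * x j) = 0) \<longrightarrow> (\<forall>j\<in>J. x j = 0))"

definition qrank :: "quat mat \<Rightarrow> nat" where
  "qrank A = Max {card J | J. J \<subseteq> {0..<dim_col A} \<and> right_indep_cols A J}"

definition cyc_len :: "(nat \<Rightarrow> nat) \<Rightarrow> nat \<Rightarrow> nat" where
  "cyc_len \<sigma> c = (LEAST k. 0 < k \<and> (\<sigma> ^^ k) c = c)"

definition cyc_prod :: "quat mat \<Rightarrow> (nat \<Rightarrow> nat) \<Rightarrow> nat \<Rightarrow> quat" where
  "cyc_prod F \<sigma> c = prod_list (map (\<lambda>k. F $$ ((\<sigma> ^^ k) c, (\<sigma> ^^ Suc k) c)) [0..<cyc_len \<sigma> c])"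

definition cyc_leaders :: "nat \<Rightarrow> (nat \<Rightarrow> nat) \<Rightarrow> nat set" where
  "cyc_leaders n \<sigma> = {x. x < n \<and> (\<forall>k. x \<le> (\<sigma> ^^ k) x)}"

definition other_leaders :: "nat \<Rightarrow> (nat \<Rightarrow> nat) \<Rightarrow> nat \<Rightarrow> nat set" where
  "other_leaders n \<sigma> i = {x \<in> cyc_leaders n \<sigma>. \<forall>k. (\<sigma> ^^ k) i \<noteq> x}"

definition rdet :: "nat \<Rightarrow> quat mat \<Rightarrow> quat" where
  "rdet i F = (let n = dim_row F in
     \<Sum>\<sigma> \<in> {\<sigma>. \<sigma> permutes {0..<n}}.
       (- 1) ^ (n - card (cyc_leaders n \<sigma>)) *
       (cyc_prod F \<sigma> i *
        prod_list (map (cyc_prod F \<sigma>) (sorted_list_of_set (other_leaders n \<sigma> i)))))"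

definition cdet :: "nat \<Rightarrow> quat mat \<Rightarrow> quat" where
  "cdet j F = (let n = dim_row F in
     \<Sum>\<tau> \<in> {\<tau>. \<tau> permutes {0..<n}}.
       (- 1) ^ (n - card (cyc_leaders n \<tau>)) *
       (prod_list (map (cyc_prod F \<tau>) (rev (sorted_list_of_set (other_leaders n \<tau> j)))) *
        cyc_prod F \<tau> j))"

text \<open>Determinant of a Hermitian matrix (= any rdet_i = cdet_i); 1 for the empty matrix.\<close>
definition hdet :: "quat mat \<Rightarrow> quat" where
  "hdet F = (if dim_row F = 0 then 1 else rdet 0 F)"

text \<open>L_{k,n} (index sequences as sets), I_{k,n}{i} = J_{k,n}{i}.\<close>
definition Lk :: "nat \<Rightarrow> nat \<Rightarrow> nat set set" where
  "Lk k n = {\<beta>. \<beta> \<subseteq> {0..<n} \<and> card \<beta> = k}"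
definition Lki :: "nat \<Rightarrow> nat \<Rightarrow> nat \<Rightarrow> nat set set" where
  "Lki k n i = {\<beta> \<in> Lk k n. i \<in> \<beta>}"

definition psub :: "quat mat \<Rightarrow> nat set \<Rightarrow> quat mat" where
  "psub F \<beta> = mat (card \<beta>) (card \<beta>)
     (\<lambda>(a, b). F $$ (sorted_list_of_set \<beta> ! a, sorted_list_of_set \<beta> ! b))"

definition pos_in :: "nat set \<Rightarrow> nat \<Rightarrow> nat" where
  "pos_in \<beta> i = card {x \<in> \<beta>. x < i}"

definition col_repl :: "quat mat \<Rightarrow> nat \<Rightarrow> quat vec \<Rightarrow> quat mat" where
  "col_repl F j b = mat (dim_row F) (dim_col F) (\<lambda>(a, c). if c = j then b $ a else F $$ (a, c))"
definition row_repl :: "quat mat \<Rightarrow> nat \<Rightarrow> quat vec \<Rightarrow> quat mat" where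
  "row_repl F i b = mat (dim_row F) (dim_col F) (\<lambda>(a, c). if a = i then b $ c else F $$ (a, c))"

definition cdet_sub :: "quat mat \<Rightarrow> nat \<Rightarrow> quat vec \<Rightarrow> nat set \<Rightarrow> quat" where
  "cdet_sub G i b \<beta> = cdet (pos_in \<beta> i) (psub (col_repl G i b) \<beta>)"
definition rdet_sub :: "quat mat \<Rightarrow> nat \<Rightarrow> quat vec \<Rightarrow> nat set \<Rightarrow> quat" where
  "rdet_sub G j b \<alpha> = rdet (pos_in \<alpha> j) (psub (row_repl G j b) \<alpha>)"

definition minsum :: "nat \<Rightarrow> quat mat \<Rightarrow> quat" where
  "minsum k F = (\<Sum>\<beta>\<in>Lk k (dim_row F). hdet (psub F \<beta>))"

end

theory Submission
  imports Defs "HOL-Combinatorics.Cycles"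
begin

text \<open>For a Hermitian matrix \<open>F\<close>, removing the vertex \<open>i\<close> from the cycle through \<open>i\<close> gives a recursion for the
  column determinant whose \<open>i\<close>th column is replaced by \<open>b\<close>; by induction it yields a self-adjoint matrix of cofactors
  \<open>cof\<close> with \<open>cof F = F cof = det F\<close> for every principal submatrix. Let \<open>G = A\<^sup>* A\<close>, and let \<open>L\<^sub>k\<close> and \<open>d\<^sub>k\<close> be the sums
  of the (zero-extended) cofactor matrices and of the determinants over all principal submatrices of size \<open>k\<close>. Then
  \<open>L\<^sub>k\<^sub>+\<^sub>1 + L\<^sub>k G = d\<^sub>k I\<close>. If \<open>r\<close> is the rank of \<open>A\<close>, then \<open>L\<^sub>r\<^sub>+\<^sub>1 A\<^sup>* = 0\<close> because all minors of size \<open>r + 1\<close> are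
  singular, and \<open>d\<^sub>r > 0\<close>. Hence \<open>L\<^sub>r A\<^sup>* = d\<^sub>r A\<^sup>\<dagger>\<close>. Taking traces in \<open>L\<^sub>r G = d\<^sub>r - L\<^sub>r\<^sub>+\<^sub>1\<close> shows that
  \<open>r\<close> is the trace of \<open>A\<^sup>\<dagger> A\<close>, so \<open>A\<close> and \<open>A\<^sup>*\<close> have equal rank, and row determinants reduce to column determinants
  by conjugate transposition. All formulas of the theorem are products of such representations.\<close>

section \<open>Quaternions\<close>

text \<open>The sums \<open>L_k\<close> and \<open>d_k\<close> are the coefficients of t^(n-k) in
  adj (t + G) and det (t + G). The Moore-Penrose inverse is the limit of (t + G)^(-1)
  \<open>ctr A\<close> for t tending to 0, so it has to be the quotient of the lowest surviving
  coefficients, those with k = r. Comparing coefficients replaces the limit by identities between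
  principal minors. The obstacle is noncommutativity: the order of the cycles in a term depends on
  the distinguished index, so it is not evident that column determinants at different indices agree.
  Realness is the remedy: Hermitian determinants are self-conjugate, hence central. That
  \<open>cof\<close> times \<open>F\<close> vanishes off the diagonal is a plain induction, but
  equality of its diagonal entries is first obtained only for indices joined by a nonzero entry;
  perturbing a zero entry closes this gap. Positivity needs no spectral theory: the squared norm of
  A applied to a cofactor column is a product of two nested principal minors. This gives both
  \<open>d_r > 0\<close> and the annihilation of \<open>ctr A\<close> by
  \<open>L_(r+1)\<close>.\<close>

lemma qcnj_sel [simp]: "qre (qcnj x) = qre x" "qi (qcnj x) = - qi x" "qj (qcnj x) = - qj x" "qk (qcnj x) = - qk x"
  by (simp_all add: qcnj_def)

lemma qcnj_simps [simp]:
  "qcnj 0 = 0" "qcnj 1 = 1" "qcnj (qcnj x) = x" "qcnj (x + y) = qcnj x + qcnj y"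
  "qcnj (x - y) = qcnj x - qcnj y" "qcnj (- x) = - qcnj x" "qcnj (x * y) = qcnj y * qcnj x"
  by (simp_all add: quat_eq_iff algebra_simps)

lemma qcnj_sum [simp]: "qcnj (sum f A) = (\<Sum>x\<in>A. qcnj (f x))"
  by (induction A rule: infinite_finite_induct) auto

lemma qcnj_power [simp]: "qcnj (x ^ n) = qcnj x ^ n"
  by (induction n) (auto simp: power_commutes)

lemma qcnj_prod_list: "qcnj (prod_list xs) = prod_list (map qcnj (rev xs))"
  by (induction xs) auto

lemma qre_sum: "qre (sum f A) = (\<Sum>x\<in>A. qre (f x))"
  by (induction A rule: infinite_finite_induct) auto

text \<open>Self-conjugate quaternions are real, hence central. Every Hermitian determinant is of
  this kind, which is how it gets past entries that do not commute.\<close>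

lemma real_quat_commute: "qcnj d = d \<Longrightarrow> d * x = x * d"
  by (auto simp: quat_eq_iff)

lemma quat_inverse:
  assumes "x \<noteq> (0::quat)"
  shows "inverse x * x = 1" "x * inverse x = 1"
proof -
  define d where "d = (qre x)\<^sup>2 + (qi x)\<^sup>2 + (qj x)\<^sup>2 + (qk x)\<^sup>2"
  have "d \<noteq> 0"
    using assms unfolding d_def quat_eq_iff quat_sel
    by (smt (verit) zero_le_power2 zero_less_power2)
  moreover have i: "inverse x = Quat (qre x / d) (- qi x / d) (- qj x / d) (- qk x / d)"
    by (simp add: inverse_quat_def d_def Let_def)
  ultimately show "inverse x * x = 1" "x * inverse x = 1"
    unfolding i quat_eq_iff quat_sel quat.sel times_divide_eq_left times_divide_eq_right
      minus_divide_left[symmetric]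
    by (simp_all add: diff_divide_distrib[symmetric] add_divide_distrib[symmetric] mult.commute)
      (simp_all add: d_def power2_eq_square)
qed

lemma quat_mult_eq_0_iff [simp]: "x * y = 0 \<longleftrightarrow> x = 0 \<or> (y::quat) = 0"
  by (metis mult.assoc mult_1 mult_zero_left mult_zero_right quat_inverse(1))

lemma real_quat_inverse: "qcnj d = d \<Longrightarrow> qcnj (inverse d) = inverse d"
  by (auto simp: quat_eq_iff inverse_quat_def Let_def)

lemma qre_norm: "qre (qcnj x * x) \<ge> 0" "x \<noteq> 0 \<Longrightarrow> qre (qcnj x * x) > 0"
  apply (simp_all add: power2_eq_square[symmetric])
  unfolding quat_eq_iff quat_sel by (smt (verit) zero_le_power2 zero_less_power2)

text \<open>Quaternions do not commute, but the real part of a product is symmetric; this makes the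
  real part of the trace cyclic.\<close>

lemma qre_mult_commute: "qre (x * y) = qre (y * x)"
  by simp

section \<open>Cycles and column determinants\<close>

text \<open>Entries are a function and the vertices an arbitrary finite set, so that principal
  submatrices need no renumbering and inductions can remove a vertex.\<close>

definition cycle_prod :: "(nat \<Rightarrow> nat \<Rightarrow> quat) \<Rightarrow> (nat \<Rightarrow> nat) \<Rightarrow> nat \<Rightarrow> quat" where
  "cycle_prod F \<tau> c = prod_list (map (\<lambda>k. F ((\<tau> ^^ k) c) ((\<tau> ^^ Suc k) c)) [0..<cyc_len \<tau> c])"

definition leaders :: "nat set \<Rightarrow> (nat \<Rightarrow> nat) \<Rightarrow> nat set" where
  "leaders V \<tau> = {x \<in> V. \<forall>k. x \<le> (\<tau> ^^ k) x}"

definition leaders_off :: "nat set \<Rightarrow> (nat \<Rightarrow> nat) \<Rightarrow> nat \<Rightarrow> nat set" where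
  "leaders_off V \<tau> i = {x \<in> leaders V \<tau>. \<forall>k. (\<tau> ^^ k) i \<noteq> x}"

text \<open>The factor \<open>q\<close>, put in front of the distinguished cycle, makes the recursion
  \<open>cdet_on_insert\<close> possible although the other cycles stand to the left of that cycle.\<close>

definition cdet_on :: "nat set \<Rightarrow> nat \<Rightarrow> quat \<Rightarrow> (nat \<Rightarrow> nat \<Rightarrow> quat) \<Rightarrow> quat" where
  "cdet_on V i q F = (\<Sum>\<tau> | \<tau> permutes V. (- 1) ^ (card V - card (leaders V \<tau>)) *
     (prod_list (map (cycle_prod F \<tau>) (rev (sorted_list_of_set (leaders_off V \<tau> i)))) * (q * cycle_prod F \<tau> i)))"

text \<open>No distinguished index: cycles are multiplied by decreasing leader, so the cycle of the
  least vertex comes last, and the empty set gives 1.\<close>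

definition det_on :: "nat set \<Rightarrow> (nat \<Rightarrow> nat \<Rightarrow> quat) \<Rightarrow> quat" where
  "det_on V F = (\<Sum>\<tau> | \<tau> permutes V. (- 1) ^ (card V - card (leaders V \<tau>)) *
     prod_list (map (cycle_prod F \<tau>) (rev (sorted_list_of_set (leaders V \<tau>)))))"

definition repl_col :: "(nat \<Rightarrow> nat \<Rightarrow> quat) \<Rightarrow> nat \<Rightarrow> (nat \<Rightarrow> quat) \<Rightarrow> nat \<Rightarrow> nat \<Rightarrow> quat" where
  "repl_col F i b = (\<lambda>a c. if c = i then b a else F a c)"

section \<open>Orbits and cycle leaders\<close>

lemma funpow_in: "(\<tau> :: nat \<Rightarrow> nat) permutes V \<Longrightarrow> x \<in> V \<Longrightarrow> (\<tau> ^^ k) x \<in> V"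
  by (induction k) (auto simp: permutes_in_image)

lemma funpow_period:
  fixes \<tau> :: "nat \<Rightarrow> nat"
  assumes "\<tau> permutes V" "finite V"
  shows "\<exists>N>0. (\<tau> ^^ N) x = x"
proof -
  have "permutation \<tau>" using assms permutes_imp_permutation by blast
  then obtain n where "(\<tau> ^^ n) = id" "n > 0" using permutation_is_nilpotent by blast
  then show ?thesis by auto
qed

lemma cyc_len:
  assumes "\<tau> permutes V" "finite V"
  shows "0 < cyc_len \<tau> x" "(\<tau> ^^ cyc_len \<tau> x) x = x"
    "0 < k \<Longrightarrow> k < cyc_len \<tau> x \<Longrightarrow> (\<tau> ^^ k) x \<noteq> x"
  using LeastI_ex[OF funpow_period[OF assms, of x]] not_less_Least[of k "\<lambda>k. 0 < k \<and> (\<tau> ^^ k) x = x"]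
  by (auto simp: cyc_len_def)

lemma cyc_len_eqI:
  fixes \<tau> :: "nat \<Rightarrow> nat"
  assumes "0 < L" "(\<tau> ^^ L) x = x" "\<And>k. 0 < k \<Longrightarrow> k < L \<Longrightarrow> (\<tau> ^^ k) x \<noteq> x"
  shows "cyc_len \<tau> x = L"
  unfolding cyc_len_def by (rule Least_equality) (use assms in \<open>auto simp: not_less[symmetric]\<close>)

lemma funpow_cyc_lenE:
  fixes \<tau> :: "nat \<Rightarrow> nat"
  assumes "\<tau> permutes V" "finite V" "(\<tau> ^^ k) x = y"
  obtains k' where "k' < cyc_len \<tau> x" "(\<tau> ^^ k') x = y"
  using cyc_len[OF assms(1,2), of x] assms(3) funpow_mod_eq[where f = \<tau> and n = "cyc_len \<tau> x" and x = x and m = k]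
  by (metis mod_less_divisor)

lemma funpow_returns:
  fixes \<tau> :: "nat \<Rightarrow> nat"
  assumes "\<tau> permutes V" "finite V" "(\<tau> ^^ k) x = y"
  shows "\<exists>l. (\<tau> ^^ l) y = x"
proof -
  obtain k' where k': "k' < cyc_len \<tau> x" "(\<tau> ^^ k') x = y" using funpow_cyc_lenE[OF assms] .
  have "(\<tau> ^^ (cyc_len \<tau> x - k')) y = (\<tau> ^^ (cyc_len \<tau> x - k' + k')) x"
    unfolding funpow_add using k' by simp
  then show ?thesis using k' cyc_len(2)[OF assms(1,2), of x] by auto
qed

lemma funpow_orbit_sym:
  fixes \<tau> :: "nat \<Rightarrow> nat"
  assumes "\<tau> permutes V" "finite V"
  shows "(\<exists>k. (\<tau> ^^ k) x = y) \<longleftrightarrow> (\<exists>k. (\<tau> ^^ k) y = x)"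
  using funpow_returns[OF assms] by blast

text \<open>The least element of the orbit of \<open>i\<close> is a leader; a leader lies below its
  whole orbit, so there is no second one.\<close>

lemma leaders_eq_insert:
  assumes "\<tau> permutes V" "finite V" "i \<in> V"
  shows "\<exists>x. leaders V \<tau> = insert x (leaders_off V \<tau> i) \<and> x \<notin> leaders_off V \<tau> i \<and> (\<exists>k. (\<tau> ^^ k) i = x)"
proof -
  let ?P = "\<lambda>x. \<exists>k. (\<tau> ^^ k) i = x"
  define x where "x = (LEAST x. ?P x)"
  have "?P x" unfolding x_def by (rule LeastI_ex) auto
  then obtain k where k: "(\<tau> ^^ k) i = x" ..
  have le: "x \<le> (\<tau> ^^ l) i" for l unfolding x_def by (rule Least_le) auto
  have "x \<le> (\<tau> ^^ l) x" for l
    using le[of "l + k"] by (simp add: funpow_add k)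
  then have xl: "x \<in> leaders V \<tau>"
    using k funpow_in[OF assms(1,3)] by (auto simp: leaders_def)
  have "y = x" if yl: "y \<in> leaders V \<tau>" "(\<tau> ^^ l) i = y" for y l
  proof -
    obtain l' where l': "(\<tau> ^^ l') y = i" using funpow_returns[OF assms(1,2) yl(2)] by blast
    have "(\<tau> ^^ (k + l')) y = x" by (simp add: funpow_add l' k)
    then have "y \<le> x" using that(1) by (auto simp: leaders_def)
    with le[of l] that show ?thesis by simp
  qed
  then have "leaders V \<tau> = insert x (leaders_off V \<tau> i)"
    using xl by (auto simp: leaders_off_def)
  moreover have "x \<notin> leaders_off V \<tau> i" using k by (auto simp: leaders_off_def)
  ultimately show ?thesis using k by blast
qed

lemma finite_leaders [simp]: "finite V \<Longrightarrow> finite (leaders V \<tau>)" "finite V \<Longrightarrow> finite (leaders_off V \<tau> i)"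
  by (auto simp: leaders_def leaders_off_def)

lemma leaders_subset: "leaders V \<tau> \<subseteq> V" by (auto simp: leaders_def)

lemma card_leaders:
  assumes "\<tau> permutes V" "finite V" "i \<in> V"
  shows "card (leaders V \<tau>) = Suc (card (leaders_off V \<tau> i))"
  using leaders_eq_insert[OF assms] assms(2) by (metis card_insert_disjoint finite_leaders(2))

text \<open>The least vertex leads its own cycle and comes first in the sorted list, hence last
  after the reversal in \<open>det_on\<close>, where \<open>cdet_on\<close> has its distinguished
  cycle.\<close>

lemma leaders_Min:
  assumes "\<tau> permutes V" "finite V" "V \<noteq> {}"
  shows "sorted_list_of_set (leaders V \<tau>) = Min V # sorted_list_of_set (leaders_off V \<tau> (Min V))"
proof -
  let ?m = "Min V"
  have m: "?m \<in> V" using assms by simp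
  have ml: "?m \<in> leaders V \<tau>"
    using funpow_in[OF assms(1) m] assms by (auto simp: leaders_def)
  obtain x k where x: "leaders V \<tau> = insert x (leaders_off V \<tau> ?m)" "x \<notin> leaders_off V \<tau> ?m"
    using leaders_eq_insert[OF assms(1,2) m] by blast
  have "?m \<notin> leaders_off V \<tau> ?m"
    using funpow_0[of \<tau> ?m] unfolding leaders_off_def by blast
  then have xm: "x = ?m" using ml unfolding x(1) by simp
  have "Min (leaders V \<tau>) = ?m"
    by (rule Min_eqI) (use ml assms leaders_subset[of V \<tau>] in \<open>auto intro: Min_le\<close>)
  moreover have "leaders V \<tau> - {?m} = leaders_off V \<tau> ?m" using x xm by auto
  ultimately show ?thesis
    using sorted_list_of_set_nonempty[of "leaders V \<tau>"] ml assms by auto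
qed

lemma det_on_eq_cdet_on:
  assumes "finite V" "V \<noteq> {}"
  shows "det_on V F = cdet_on V (Min V) 1 F"
  unfolding det_on_def cdet_on_def
  by (rule sum.cong) (use assms in \<open>auto simp: leaders_Min\<close>)

lemma det_on_empty [simp]: "det_on {} F = 1"
proof -
  have "{\<tau>. \<tau> permutes ({}::nat set)} = {id}" by auto
  moreover have "leaders {} id = {}" by (auto simp: leaders_def)
  ultimately show ?thesis by (simp add: det_on_def)
qed

section \<open>Inserting a vertex into a cycle\<close>

context
  fixes i j :: nat and W :: "nat set" and \<tau>' \<tau> :: "nat \<Rightarrow> nat"
  assumes W: "finite W" "i \<notin> W" "j \<in> W" and \<tau>': "\<tau>' permutes W"
    and \<tau>_def: "\<tau> = transpose i j \<circ> \<tau>'"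
begin

lemma detour_permutes: "\<tau> permutes insert i W"
  unfolding \<tau>_def
  by (intro permutes_compose permutes_swap_id permutes_imp_permutes_insert \<tau>') (use W in auto)

text \<open>Composing with the transposition puts \<open>i\<close> on the cycle of \<open>j\<close>,
  directly before \<open>j\<close>: \<open>i\<close> goes to \<open>j\<close>, the former
  predecessor of \<open>j\<close> goes to \<open>i\<close>, and all other arrows are kept.\<close>

lemma detour_start: "k < cyc_len \<tau>' j \<Longrightarrow> (\<tau> ^^ Suc k) i = (\<tau>' ^^ k) j"
proof (induction k)
  case 0
  then show ?case using permutes_not_in[OF \<tau>' W(2)] by (simp add: \<tau>_def)
next
  case (Suc k)
  have "(\<tau> ^^ Suc (Suc k)) i = \<tau> ((\<tau>' ^^ k) j)"
    using Suc by simp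
  also have "\<dots> = transpose i j ((\<tau>' ^^ Suc k) j)"
    by (simp add: \<tau>_def)
  also have "\<dots> = (\<tau>' ^^ Suc k) j"
    using funpow_in[OF \<tau>' W(3), of "Suc k"] cyc_len(3)[OF \<tau>' W(1) _ Suc.prems] W(2)
    by (metis transpose_apply_other zero_less_Suc)
  finally show ?case .
qed

lemma detour_cyc_len: "cyc_len \<tau> i = Suc (cyc_len \<tau>' j)"
proof (rule cyc_len_eqI)
  note c = cyc_len(1,2)[OF \<tau>' W(1), of j]
  obtain l where l: "cyc_len \<tau>' j = Suc l" using c(1) gr0_implies_Suc by blast
  have "(\<tau> ^^ Suc (Suc l)) i = \<tau> ((\<tau>' ^^ l) j)" using detour_start[of l] l by simp
  also have "\<dots> = transpose i j ((\<tau>' ^^ Suc l) j)" by (simp add: \<tau>_def)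
  also have "\<dots> = i" using c(2) l by simp
  finally show "(\<tau> ^^ Suc (cyc_len \<tau>' j)) i = i" using l by simp
  show "(\<tau> ^^ k) i \<noteq> i" if "0 < k" "k < Suc (cyc_len \<tau>' j)" for k
    using detour_start[of "k - 1"] that funpow_in[OF \<tau>' W(3), of "k - 1"] W(2) by auto
qed auto

lemma detour_other:
  assumes "x \<in> W" "\<And>k. (\<tau>' ^^ k) j \<noteq> x"
  shows "(\<tau> ^^ k) x = (\<tau>' ^^ k) x"
proof (induction k)
  case (Suc k)
  have "(\<tau>' ^^ Suc k) x \<noteq> j" using assms(2) funpow_returns[OF \<tau>' W(1)] by blast
  moreover have "(\<tau>' ^^ Suc k) x \<noteq> i" using funpow_in[OF \<tau>' assms(1)] W(2) by blast
  ultimately show ?case using Suc by (simp add: \<tau>_def)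
qed simp

text \<open>The cycle through \<open>i\<close> starts with the arrow to \<open>j\<close> and then
  follows the old cycle, whose last arrow now ends in \<open>i\<close> instead of \<open>j\<close>.
  Only that arrow of the old cycle reads column \<open>j\<close>, so replacing this column by column
  \<open>i\<close> records the change.\<close>

lemma detour_cycle_prod:
  "cycle_prod F \<tau> i = F i j * cycle_prod (repl_col F j (\<lambda>a. F a i)) \<tau>' j"
proof -
  let ?L = "cyc_len \<tau>' j" and ?F = "repl_col F j (\<lambda>a. F a i)"
  note c = cyc_len(1,2)[OF \<tau>' W(1), of j]
  have "cycle_prod F \<tau> i = F i (\<tau> i) * prod_list (map (\<lambda>k. F ((\<tau> ^^ Suc k) i) ((\<tau> ^^ Suc (Suc k)) i)) [0..<?L])"
    unfolding cycle_prod_def detour_cyc_len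
    by (subst upt_conv_Cons) (simp_all add: map_Suc_upt[symmetric] o_def del: upt_Suc)
  also have "\<tau> i = j" using detour_start[of 0] c(1) by simp
  also have "map (\<lambda>k. F ((\<tau> ^^ Suc k) i) ((\<tau> ^^ Suc (Suc k)) i)) [0..<?L] =
      map (\<lambda>k. ?F ((\<tau>' ^^ k) j) ((\<tau>' ^^ Suc k) j)) [0..<?L]"
  proof (rule map_cong[OF refl])
    fix k assume "k \<in> set [0..<?L]"
    then have k: "k < ?L" by simp
    show "F ((\<tau> ^^ Suc k) i) ((\<tau> ^^ Suc (Suc k)) i) = ?F ((\<tau>' ^^ k) j) ((\<tau>' ^^ Suc k) j)"
    proof (cases "Suc k < ?L")
      case True
      then show ?thesis
        using detour_start[OF k] detour_start[OF True] cyc_len(3)[OF \<tau>' W(1) _ True] by (simp only: repl_col_def) simp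
    next
      \<comment> \<open>The last arrow: \<open>\<tau>'\<close> returns to \<open>j\<close> where
        \<open>\<tau>\<close> goes to \<open>i\<close>, and the replaced column supplies the
        entry.\<close>
      case False
      then have "?L = Suc k" using k by simp
      then show ?thesis
        using detour_start[OF k] c(2) cyc_len(2)[OF detour_permutes, of i] W(1) detour_cyc_len
        by (simp only: repl_col_def) simp
    qed
  qed
  finally show ?thesis unfolding cycle_prod_def .
qed

text \<open>A cycle avoiding \<open>j\<close> never reads column \<open>j\<close>, whence the
  arbitrary \<open>b\<close>.\<close>

lemma detour_cycle_prod_other:
  assumes "x \<in> W" "\<And>k. (\<tau>' ^^ k) j \<noteq> x"
  shows "cycle_prod F \<tau> x = cycle_prod (repl_col F j b) \<tau>' x"
proof -
  have "(\<tau>' ^^ k) x \<noteq> j" for k using assms(2) funpow_returns[OF \<tau>' W(1)] by blast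
  from this[of "Suc k" for k] have "\<tau>' ((\<tau>' ^^ k) x) \<noteq> j" for k by simp
  moreover have "cyc_len \<tau> x = cyc_len \<tau>' x"
    unfolding cyc_len_def detour_other[OF assms] ..
  ultimately show ?thesis
    unfolding cycle_prod_def detour_other[OF assms] repl_col_def by auto
qed

text \<open>The leader of the lengthened cycle can change, as \<open>i\<close> may be its least
  element; leaving that cycle out on both sides avoids the question.\<close>

lemma detour_leaders_off: "leaders_off (insert i W) \<tau> i = leaders_off W \<tau>' j"
proof -
  have orbit: "(\<forall>k. (\<tau> ^^ k) i \<noteq> x) \<longleftrightarrow> (\<forall>k. (\<tau>' ^^ k) j \<noteq> x)" if x: "x \<in> W" for x
  proof
    assume *: "\<forall>k. (\<tau> ^^ k) i \<noteq> x"
    show "\<forall>k. (\<tau>' ^^ k) j \<noteq> x"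
    proof (intro allI notI)
      fix k assume "(\<tau>' ^^ k) j = x"
      then obtain k' where "k' < cyc_len \<tau>' j" "(\<tau>' ^^ k') j = x"
        using funpow_cyc_lenE[OF \<tau>' W(1)] by blast
      then show False using detour_start * by metis
    qed
  next
    assume *: "\<forall>k. (\<tau>' ^^ k) j \<noteq> x"
    then have eq: "(\<tau> ^^ k) x = (\<tau>' ^^ k) x" for k using detour_other x by blast
    have "(\<tau> ^^ k) x \<noteq> i" for k unfolding eq using funpow_in[OF \<tau>' x] W(2) by metis
    then show "\<forall>k. (\<tau> ^^ k) i \<noteq> x"
      using funpow_returns[OF detour_permutes] W(1) by blast
  qed
  have "i \<notin> leaders_off (insert i W) \<tau> i"
    using funpow_0[of \<tau> i] unfolding leaders_off_def by blast
  moreover have "x \<in> leaders_off (insert i W) \<tau> i \<longleftrightarrow> x \<in> leaders_off W \<tau>' j" if x: "x \<in> W" for x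
    using orbit[OF x] detour_other[OF x] x unfolding leaders_off_def leaders_def by auto
  ultimately show ?thesis
    unfolding leaders_off_def leaders_def by blast
qed

end

text \<open>Permutations are sorted by the image of \<open>i\<close>. Those fixing \<open>i\<close>
  leave a determinant of \<open>W\<close> to the left of \<open>q\<close>. Sending \<open>i\<close>
  to \<open>j\<close> adds a vertex but no cycle, hence the minus sign; the entry
  \<open>F i j\<close> stands between the other cycles and the rest of its own, so it joins
  \<open>q\<close>.\<close>

lemma cdet_on_insert:
  assumes "finite W" "i \<notin> W"
  shows "cdet_on (insert i W) i q F =
    det_on W F * q * F i i - (\<Sum>j\<in>W. cdet_on W j (q * F i j) (repl_col F j (\<lambda>a. F a i)))"
proof -
  let ?V = "insert i W"
  let ?f = "\<lambda>\<tau>. (- 1) ^ (card ?V - card (leaders ?V \<tau>)) *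
     (prod_list (map (cycle_prod F \<tau>) (rev (sorted_list_of_set (leaders_off ?V \<tau> i)))) * (q * cycle_prod F \<tau> i))"
  have cle: "card (leaders W \<tau>) \<le> card W" for \<tau>
    using assms leaders_subset by (simp add: card_mono)
  \<comment> \<open>The transposition is trivial for \<open>j = i\<close>; this summand gives the
    permutations that fix \<open>i\<close>.\<close>
  have "cdet_on ?V i q F = (\<Sum>j\<in>insert i W. \<Sum>\<tau> | \<tau> permutes W. ?f (transpose i j \<circ> \<tau>))"
    unfolding cdet_on_def using assms by (rule sum_over_permutations_insert)
  also have "\<dots> = (\<Sum>\<tau> | \<tau> permutes W. ?f \<tau>) + (\<Sum>j\<in>W. \<Sum>\<tau> | \<tau> permutes W. ?f (transpose i j \<circ> \<tau>))"
    using assms by (simp)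
  also have "(\<Sum>\<tau> | \<tau> permutes W. ?f \<tau>) = det_on W F * q * F i i"
    unfolding det_on_def sum_distrib_right
  proof (rule sum.cong[OF refl], clarify)
    fix \<tau> assume \<tau>: "\<tau> permutes W"
    then have \<tau>V: "\<tau> permutes ?V" by (rule permutes_imp_permutes_insert)
    have i: "(\<tau> ^^ k) i = i" for k
      using permutes_not_in[OF \<tau> assms(2)] by (induction k) auto
    have "cyc_len \<tau> i = 1" by (rule cyc_len_eqI) (use i i[of 1] in auto)
    then have 1: "cycle_prod F \<tau> i = F i i" using i[of 1] by (simp add: cycle_prod_def)
    have 2: "leaders_off ?V \<tau> i = leaders W \<tau>"
      using assms(2) by (auto simp: leaders_off_def leaders_def i)
    have "card (leaders ?V \<tau>) = Suc (card (leaders W \<tau>))"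
      using card_leaders[OF \<tau>V, of i] assms 2 by simp
    then have 3: "card ?V - card (leaders ?V \<tau>) = card W - card (leaders W \<tau>)"
      using assms by simp
    show "?f \<tau> = (- 1) ^ (card W - card (leaders W \<tau>)) *
       prod_list (map (cycle_prod F \<tau>) (rev (sorted_list_of_set (leaders W \<tau>)))) * q * F i i"
      unfolding 1 2 3 by (simp add: mult.assoc)
  qed
  also have "(\<Sum>j\<in>W. \<Sum>\<tau> | \<tau> permutes W. ?f (transpose i j \<circ> \<tau>)) =
      (\<Sum>j\<in>W. - cdet_on W j (q * F i j) (repl_col F j (\<lambda>a. F a i)))"
    unfolding cdet_on_def sum_distrib_left sum_negf[symmetric]
  proof (rule sum.cong[OF refl], rule sum.cong[OF refl], clarify)
    fix j \<tau>' assume j: "j \<in> W" and \<tau>': "\<tau>' permutes W"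
    let ?G = "repl_col F j (\<lambda>a. F a i)"
    define \<tau> where "\<tau> = transpose i j \<circ> \<tau>'"
    note ctxt = assms j \<tau>' \<tau>_def
    have 1: "cycle_prod F \<tau> i = F i j * cycle_prod ?G \<tau>' j" by (rule detour_cycle_prod[OF ctxt])
    have 2: "leaders_off ?V \<tau> i = leaders_off W \<tau>' j" by (rule detour_leaders_off[OF ctxt])
    have "card (leaders ?V \<tau>) = card (leaders W \<tau>')"
      using card_leaders[OF detour_permutes[OF ctxt], of i] card_leaders[OF \<tau>' assms(1) j] assms 2 by simp
    then have 3: "card ?V - card (leaders ?V \<tau>) = Suc (card W - card (leaders W \<tau>'))"
      using assms cle by (simp add: Suc_diff_le)
    have 4: "map (cycle_prod F \<tau>) (rev (sorted_list_of_set (leaders_off W \<tau>' j))) =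
        map (cycle_prod ?G \<tau>') (rev (sorted_list_of_set (leaders_off W \<tau>' j)))" (is "map _ ?xs = _")
    proof (rule map_cong[OF refl])
      fix x assume "x \<in> set ?xs"
      then have "x \<in> leaders_off W \<tau>' j" using assms by simp
      then show "cycle_prod F \<tau> x = cycle_prod ?G \<tau>' x"
        by (intro detour_cycle_prod_other[OF ctxt]) (auto simp: leaders_off_def leaders_def)
    qed
    show "?f (transpose i j \<circ> \<tau>') = - ((- 1) ^ (card W - card (leaders W \<tau>')) *
       (prod_list (map (cycle_prod ?G \<tau>') ?xs) * (q * F i j * cycle_prod ?G \<tau>' j)))"
      unfolding \<tau>_def[symmetric] 1 2 3 4
      by (simp add: mult.assoc)
  qed
  finally show ?thesis by (simp add: sum_negf)
qed

lemma cycle_prod_cong: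
  assumes "\<tau> permutes V" "x \<in> V" "\<And>a c. a \<in> V \<Longrightarrow> c \<in> V \<Longrightarrow> F a c = G a c"
  shows "cycle_prod F \<tau> x = cycle_prod G \<tau> x"
  unfolding cycle_prod_def
  by (intro arg_cong[where f = prod_list] map_cong refl assms(3) funpow_in[OF assms(1,2)])

lemma cdet_on_cong:
  assumes "finite V" "i \<in> V" "\<And>a c. a \<in> V \<Longrightarrow> c \<in> V \<Longrightarrow> F a c = G a c"
  shows "cdet_on V i q F = cdet_on V i q G"
  unfolding cdet_on_def
proof (rule sum.cong[OF refl], clarify)
  fix \<tau> assume \<tau>: "\<tau> permutes V"
  have *: "map (cycle_prod F \<tau>) (rev (sorted_list_of_set (leaders_off V \<tau> i))) =
      map (cycle_prod G \<tau>) (rev (sorted_list_of_set (leaders_off V \<tau> i)))"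
    by (intro map_cong refl cycle_prod_cong[OF \<tau>] assms(3))
      (use assms(1) in \<open>auto simp: leaders_off_def leaders_def\<close>)
  show "(- 1) ^ (card V - card (leaders V \<tau>)) *
     (prod_list (map (cycle_prod F \<tau>) (rev (sorted_list_of_set (leaders_off V \<tau> i)))) * (q * cycle_prod F \<tau> i)) =
     (- 1) ^ (card V - card (leaders V \<tau>)) *
     (prod_list (map (cycle_prod G \<tau>) (rev (sorted_list_of_set (leaders_off V \<tau> i)))) * (q * cycle_prod G \<tau> i))"
    using cycle_prod_cong[OF \<tau> assms(2), of F G] assms(3) by (simp add: *)
qed

lemma det_on_cong:
  assumes "finite V" "\<And>a c. a \<in> V \<Longrightarrow> c \<in> V \<Longrightarrow> F a c = G a c"
  shows "det_on V F = det_on V G"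
  using cdet_on_cong[OF assms(1) _ assms(2), of "Min V"] assms(1)
  by (cases "V = {}") (auto simp: det_on_eq_cdet_on)

section \<open>Cramer's rule for Hermitian matrices\<close>

definition cramer :: "nat set \<Rightarrow> (nat \<Rightarrow> nat \<Rightarrow> quat) \<Rightarrow> nat \<Rightarrow> (nat \<Rightarrow> quat) \<Rightarrow> quat" where
  "cramer V F i b = cdet_on V i 1 (repl_col F i b)"

text \<open>For Hermitian \<open>F\<close> these are the coefficients of \<open>cramer\<close> as a
  linear function of the replaced column. The first index is that of the replaced column, so
  \<open>cof V F\<close> is the adjugate itself and not its transpose.\<close>

definition cof :: "nat set \<Rightarrow> (nat \<Rightarrow> nat \<Rightarrow> quat) \<Rightarrow> nat \<Rightarrow> nat \<Rightarrow> quat" where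
  "cof V F i k = cramer V F i (\<lambda>a. if a = k then 1 else 0)"

definition hermitian :: "(nat \<Rightarrow> nat \<Rightarrow> quat) \<Rightarrow> bool" where
  "hermitian F \<longleftrightarrow> (\<forall>a c. F a c = qcnj (F c a))"

lemma hermitianD: "hermitian F \<Longrightarrow> qcnj (F a c) = F c a"
  unfolding hermitian_def by metis

lemma det_on_eq_cramer:
  assumes "finite V" "V \<noteq> {}"
  shows "det_on V F = cramer V F (Min V) (\<lambda>a. F a (Min V))"
  unfolding det_on_eq_cdet_on[OF assms] cramer_def
  by (rule cdet_on_cong) (use assms in \<open>auto simp: repl_col_def\<close>)

text \<open>Column \<open>i\<close> is already \<open>b\<close>, so the recursion passes the same
  \<open>b\<close> on to column \<open>j\<close> of the smaller set.\<close>

lemma cdet_on_repl_col_insert: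
  assumes "finite W" "i \<notin> W"
  shows "cdet_on (insert i W) i q (repl_col F i b) =
    det_on W F * q * b i - (\<Sum>j\<in>W. cdet_on W j (q * F i j) (repl_col F j b))"
proof -
  have "det_on W (repl_col F i b) = det_on W F"
    by (rule det_on_cong) (use assms in \<open>auto simp: repl_col_def\<close>)
  moreover have "cdet_on W j q' (repl_col (repl_col F i b) j (\<lambda>a. repl_col F i b a i)) =
      cdet_on W j q' (repl_col F j b)" if "j \<in> W" for j q'
    by (rule cdet_on_cong) (use assms that in \<open>auto simp: repl_col_def\<close>)
  moreover have "repl_col F i b i j = F i j" if "j \<in> W" for j
    using that assms by (auto simp: repl_col_def)
  ultimately show ?thesis
    unfolding cdet_on_insert[OF assms] by (simp add: repl_col_def)
qed

text \<open>These properties are carried together because each depends on the others for smaller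
  sets: moving \<open>q\<close> to the front needs a real smaller determinant, and a real
  determinant needs self-adjoint cofactors.\<close>

definition tame :: "nat set \<Rightarrow> (nat \<Rightarrow> nat \<Rightarrow> quat) \<Rightarrow> bool" where
  "tame V F \<longleftrightarrow> qcnj (det_on V F) = det_on V F \<and>
     (\<forall>i\<in>V. \<forall>q b. cdet_on V i q (repl_col F i b) = q * cramer V F i b) \<and>
     (\<forall>i\<in>V. \<forall>b. cramer V F i b = (\<Sum>k\<in>V. cof V F i k * b k)) \<and>
     (\<forall>i\<in>V. \<forall>k\<in>V. qcnj (cof V F i k) = cof V F k i) \<and>
     (\<forall>i\<in>V. cof V F i i = det_on (V - {i}) F) \<and>
     (\<forall>i\<in>V. \<forall>k\<in>V. i \<noteq> k \<longrightarrow> cof V F i k = - (\<Sum>j\<in>V - {i}. F i j * cof (V - {i}) F j k))"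

lemma tameD:
  assumes "tame V F"
  shows "qcnj (det_on V F) = det_on V F"
    and "i \<in> V \<Longrightarrow> k \<in> V \<Longrightarrow> qcnj (cof V F i k) = cof V F k i"
  using assms unfolding tame_def by blast+

lemma tame_insert:
  assumes "finite W" "i \<notin> W" "tame W F"
  shows "cramer (insert i W) F i b = det_on W F * b i - (\<Sum>j\<in>W. F i j * (\<Sum>k\<in>W. cof W F j k * b k))"
    and "cdet_on (insert i W) i q (repl_col F i b) = q * cramer (insert i W) F i b"
proof -
  have *: "cdet_on (insert i W) i q (repl_col F i b) =
    det_on W F * q * b i - (\<Sum>j\<in>W. q * F i j * (\<Sum>k\<in>W. cof W F j k * b k))" for q
    unfolding cdet_on_repl_col_insert[OF assms(1,2)] using assms(3) unfolding tame_def by auto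
  from *[of 1] show 1: "cramer (insert i W) F i b = det_on W F * b i - (\<Sum>j\<in>W. F i j * (\<Sum>k\<in>W. cof W F j k * b k))"
    by (simp add: cramer_def)
  have "det_on W F * q = q * det_on W F"
    using assms(3) by (intro real_quat_commute) (simp add: tameD)
  then show "cdet_on (insert i W) i q (repl_col F i b) = q * cramer (insert i W) F i b"
    unfolding 1 * by (simp add: right_diff_distrib sum_distrib_left mult.assoc)
qed

lemma cof_insert:
  assumes "finite W" "i \<notin> W" "tame W F"
  shows "cof (insert i W) F i i = det_on W F"
    and "k \<in> W \<Longrightarrow> cof (insert i W) F i k = - (\<Sum>j\<in>W. F i j * cof W F j k)"
proof -
  have "(\<Sum>l\<in>W. cof W F j l * (if l = i then 1 else 0)) = 0" for j
    using assms(2) by (intro sum.neutral) auto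
  then show "cof (insert i W) F i i = det_on W F"
    unfolding cof_def[of "insert i W"] tame_insert(1)[OF assms] by simp
  assume k: "k \<in> W"
  have "(\<Sum>l\<in>W. cof W F j l * (if l = k then 1 else 0)) = cof W F j k" for j
    using assms(1) k by (simp add: if_distrib[of "\<lambda>x. _ * x"] cong: if_cong)
  then show "cof (insert i W) F i k = - (\<Sum>j\<in>W. F i j * cof W F j k)"
    unfolding cof_def[of "insert i W"] tame_insert(1)[OF assms] using k assms(2) by auto
qed

lemma cramer_insert:
  assumes "finite W" "i \<notin> W" "tame W F"
  shows "cramer (insert i W) F i b = (\<Sum>k\<in>insert i W. cof (insert i W) F i k * b k)"
proof -
  have "(\<Sum>k\<in>W. cof (insert i W) F i k * b k) = - (\<Sum>k\<in>W. \<Sum>j\<in>W. F i j * cof W F j k * b k)"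
    unfolding sum_negf[symmetric] by (intro sum.cong refl) (simp add: cof_insert(2)[OF assms] sum_distrib_right sum_negf)
  also have "(\<Sum>k\<in>W. \<Sum>j\<in>W. F i j * cof W F j k * b k) = (\<Sum>j\<in>W. F i j * (\<Sum>k\<in>W. cof W F j k * b k))"
    by (subst sum.swap) (simp add: sum_distrib_left mult.assoc)
  finally show ?thesis
    unfolding tame_insert(1)[OF assms] using assms by (simp add: cof_insert(1)[OF assms])
qed

text \<open>Applying the recursion for \<open>cof\<close> on both sides writes an off-diagonal entry as an
  expression in \<open>cof (V - {i, k})\<close> that is visibly self-adjoint.\<close>

lemma tame:
  assumes "finite V" "hermitian F"
  shows "tame V F"
  using assms(1)
proof (induction V rule: finite_psubset_induct)
  case (psubset V)
  have t: "tame (V - {i}) F" if "i \<in> V" for i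
    using that by (intro psubset.IH) auto
  have f: "finite (V - {i})" "i \<notin> V - {i}" for i using psubset(1) by auto
  have ins: "insert i (V - {i}) = V" if "i \<in> V" for i using that by auto
  note H = hermitianD[OF assms(2)]
  have two: "cof V F i k = - F i k * det_on (V - {i,k}) F
      + (\<Sum>j\<in>V - {i,k}. \<Sum>l\<in>V - {i,k}. F i j * cof (V - {i,k}) F j l * F l k)"
    if ik: "i \<in> V" "k \<in> V" "i \<noteq> k" for i k
  proof -
    let ?W = "V - {i,k}" and ?U = "V - {i}"
    have kU: "k \<in> ?U" using ik by auto
    have tW: "tame ?W F" using ik by (intro psubset.IH) auto
    have eq: "?U = insert k ?W" "k \<notin> ?W" "finite ?W" using ik psubset(1) by auto
    have tU: "tame ?U F" by (rule t[OF ik(1)])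
    have d: "cof ?U F k k = det_on ?W F" using cof_insert(1)[OF eq(3,2) tW] eq(1) by simp
    have o: "cof ?U F j k = - (\<Sum>l\<in>?W. cof ?W F j l * F l k)" if j: "j \<in> ?W" for j
    proof -
      \<comment> \<open>\<open>cof_insert\<close> expands along a row; conjugation within
        \<open>?U\<close>, where \<open>tame\<close> is known, turns this into an expansion along
        column \<open>k\<close>.\<close>
      have "cof ?U F j k = qcnj (cof ?U F k j)"
        using tU j kU ik by (simp add: tameD)
      also have "cof ?U F k j = - (\<Sum>l\<in>?W. F k l * cof ?W F l j)"
        using cof_insert(2)[OF eq(3,2) tW j] eq(1) by simp
      also have "qcnj \<dots> = - (\<Sum>l\<in>?W. cof ?W F j l * F l k)"
        using tW j by (simp add: tameD H)
      finally show ?thesis .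
    qed
    have "cof V F i k = - (\<Sum>j\<in>?U. F i j * cof ?U F j k)"
      using cof_insert(2)[OF f tU kU] ins[OF ik(1)] by simp
    also have "(\<Sum>j\<in>?U. F i j * cof ?U F j k) = F i k * det_on ?W F + (\<Sum>j\<in>?W. F i j * cof ?U F j k)"
      using sum.remove[OF f(1) kU, of "\<lambda>j. F i j * cof ?U F j k"] d Diff_insert2[of V i "{k}"] by simp
    also have "(\<Sum>j\<in>?W. F i j * cof ?U F j k) = - (\<Sum>j\<in>?W. \<Sum>l\<in>?W. F i j * cof ?W F j l * F l k)"
      unfolding sum_negf[symmetric] by (intro sum.cong refl) (simp add: o sum_distrib_left mult.assoc sum_negf)
    finally show ?thesis by simp
  qed
  have sym: "qcnj (cof V F i k) = cof V F k i" if ik: "i \<in> V" "k \<in> V" for i k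
  proof (cases "i = k")
    case True
    have "cof V F i i = det_on (V - {i}) F"
      using cof_insert(1)[OF f t[OF ik(1)]] ins[OF ik(1)] by simp
    then show ?thesis using t[OF ik(1)] True by (simp add: tameD)
  next
    case False
    let ?W = "V - {i,k}"
    have tW: "tame ?W F" using ik by (intro psubset.IH) auto
    have W: "V - {k,i} = ?W" by auto
    have d: "det_on ?W F * x = x * det_on ?W F" for x
      using tW by (intro real_quat_commute) (simp add: tameD)
    have "qcnj (cof V F i k) = - F k i * det_on ?W F + (\<Sum>j\<in>?W. \<Sum>l\<in>?W. F k l * cof ?W F l j * F j i)"
      using tW unfolding two[OF ik False] by (simp add: tameD H d mult.assoc)
    also have "\<dots> = cof V F k i"
      using ik False unfolding two[OF ik(2,1) not_sym[OF False]] W by (subst sum.swap) simp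
    finally show ?thesis .
  qed
  have real: "qcnj (det_on V F) = det_on V F"
  proof (cases "V = {}")
    case False
    let ?i = "Min V"
    let ?W = "V - {?i}"
    have i: "?i \<in> V" using False psubset(1) by simp
    have d: "det_on ?W F * x = x * det_on ?W F" for x
      using t[OF i] by (intro real_quat_commute) (simp add: tameD)
    \<comment> \<open>The double sum is a row times the cofactors times the adjoint column, so
      conjugation merely swaps \<open>j\<close> and \<open>k\<close>.\<close>
    have e: "det_on V F = det_on ?W F * F ?i ?i - (\<Sum>j\<in>?W. \<Sum>k\<in>?W. F ?i j * cof ?W F j k * F k ?i)"
      unfolding det_on_eq_cramer[OF psubset(1) False]
      using tame_insert(1)[OF f t[OF i], of "\<lambda>a. F a ?i"] ins[OF i]
      by (simp add: sum_distrib_left mult.assoc)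
    have "qcnj (\<Sum>j\<in>?W. \<Sum>k\<in>?W. F ?i j * cof ?W F j k * F k ?i) =
        (\<Sum>j\<in>?W. \<Sum>k\<in>?W. F ?i k * cof ?W F k j * F j ?i)"
      using t[OF i] by (simp add: tameD H mult.assoc)
    also have "\<dots> = (\<Sum>j\<in>?W. \<Sum>k\<in>?W. F ?i j * cof ?W F j k * F k ?i)"
      by (rule sum.swap)
    finally show ?thesis
      using t[OF i] unfolding e by (simp add: tameD H d)
  qed simp
  show ?case
    unfolding tame_def
    using real sym tame_insert(2)[OF f t] cof_insert[OF f t] cramer_insert[OF f t] ins
    by auto
qed

lemmas
  det_on_real = tame[unfolded tame_def, THEN conjunct1] and
  cramer_eq_sum = tame[unfolded tame_def, THEN conjunct2, THEN conjunct2, THEN conjunct1, rule_format] and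
  cof_sym = tame[unfolded tame_def, THEN conjunct2, THEN conjunct2, THEN conjunct2, THEN conjunct1, rule_format] and
  cof_diag = tame[unfolded tame_def, THEN conjunct2, THEN conjunct2, THEN conjunct2, THEN conjunct2, THEN conjunct1, rule_format] and
  cof_off_diag = tame[unfolded tame_def, THEN conjunct2, THEN conjunct2, THEN conjunct2, THEN conjunct2, THEN conjunct2, rule_format]

lemma cramer_recursion:
  assumes "finite V" "hermitian F" "i \<in> V"
  shows "cramer V F i b = det_on (V - {i}) F * b i - (\<Sum>j\<in>V - {i}. F i j * cramer (V - {i}) F j b)"
proof -
  have V: "insert i (V - {i}) = V" using assms by auto
  have "finite (V - {i})" "i \<notin> V - {i}" using assms by auto
  note * = tame_insert(1)[OF this tame[OF this(1) assms(2)], of b]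
  then show ?thesis
    using cramer_eq_sum[of "V - {i}" F] assms unfolding V by simp
qed

section \<open>Continuity of Hermitian determinants in a real parameter\<close>

definition qcont :: "(real \<Rightarrow> quat) \<Rightarrow> bool" where
  "qcont f \<longleftrightarrow> isCont (\<lambda>t. qre (f t)) 0 \<and> isCont (\<lambda>t. qi (f t)) 0 \<and>
     isCont (\<lambda>t. qj (f t)) 0 \<and> isCont (\<lambda>t. qk (f t)) 0"

lemma qcont_const: "qcont (\<lambda>t. c)"
  and qcont_add: "qcont f \<Longrightarrow> qcont g \<Longrightarrow> qcont (\<lambda>t. f t + g t)"
  and qcont_diff: "qcont f \<Longrightarrow> qcont g \<Longrightarrow> qcont (\<lambda>t. f t - g t)"
  and qcont_minus: "qcont f \<Longrightarrow> qcont (\<lambda>t. - f t)"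
  and qcont_mult: "qcont f \<Longrightarrow> qcont g \<Longrightarrow> qcont (\<lambda>t. f t * g t)"
  unfolding qcont_def quat_sel by (auto intro!: continuous_intros)

lemma qcont_sum: "(\<And>x. x \<in> A \<Longrightarrow> qcont (f x)) \<Longrightarrow> qcont (\<lambda>t. \<Sum>x\<in>A. f x t)"
  by (induction A rule: infinite_finite_induct) (auto intro: qcont_const qcont_add)

lemmas qcont_intros = qcont_const qcont_add qcont_diff qcont_minus qcont_mult qcont_sum

text \<open>Meant for the parameter value 0, where the perturbation used in Cramer's rule is
  switched off.\<close>

lemma qcont_eqI:
  assumes "qcont f" "qcont g" "\<And>t. t \<noteq> 0 \<Longrightarrow> f t = g t"
  shows "f 0 = g 0"
proof -
  have *: "u 0 = v 0" if "isCont u 0" "isCont v 0" "\<And>t. t \<noteq> 0 \<Longrightarrow> u t = v t" for u v :: "real \<Rightarrow> real"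
  proof -
    have "(u \<longlongrightarrow> v 0) (at 0)"
      using that(2) tendsto_cong[of u v "at 0" "v 0"] that(3)
      by (auto simp: isCont_def eventually_at_filter)
    with that(1) show ?thesis unfolding isCont_def by (rule LIM_unique)
  qed
  show ?thesis
    using assms unfolding qcont_def quat_eq_iff
    by (intro conjI; elim conjE) (rule *; simp)+
qed

text \<open>The recursions write determinants and cofactors as sums of products of entries with
  determinants and cofactors of smaller sets.\<close>

lemma qcont_cof_det:
  assumes "finite V" "\<And>t. hermitian (F t)" "\<And>a c. qcont (\<lambda>t. F t a c)"
  shows "qcont (\<lambda>t. det_on V (F t)) \<and> (\<forall>i\<in>V. \<forall>k\<in>V. qcont (\<lambda>t. cof V (F t) i k))"
  using assms(1)
proof (induction V rule: finite_psubset_induct)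
  case (psubset V)
  have IH: "qcont (\<lambda>t. det_on (V - {i}) (F t))"
    "j \<in> V - {i} \<Longrightarrow> k \<in> V - {i} \<Longrightarrow> qcont (\<lambda>t. cof (V - {i}) (F t) j k)" if "i \<in> V" for i j k
    using psubset.IH[of "V - {i}"] that by auto
  have c: "qcont (\<lambda>t. cof V (F t) i k)" if ik: "i \<in> V" "k \<in> V" for i k
  proof (cases "i = k")
    case True
    then show ?thesis using IH ik by (simp add: cof_diag[OF psubset(1) assms(2)])
  next
    case False
    then show ?thesis using IH ik
      by (auto simp add: cof_off_diag[OF psubset(1) assms(2)] intro!: qcont_intros assms(3))
  qed
  moreover have "qcont (\<lambda>t. det_on V (F t))"
  proof (cases "V = {}")
    case False
    then have m: "Min V \<in> V" using psubset(1) by simp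
    then show ?thesis
      by (auto simp add: det_on_eq_cramer[OF psubset(1) False] cramer_eq_sum[OF psubset(1) assms(2) m]
          intro!: qcont_intros assms(3) c)
  qed (simp add: qcont_const)
  ultimately show ?case by blast
qed

text \<open>With \<open>T\<close> the diagonal matrix of the values \<open>cramer V F i (\<lambda>a. F a i)\<close>, the matrix \<open>cof V F\<close>
  satisfies \<open>cof F = T\<close> by induction, and \<open>F cof = T\<close> by conjugation. Hence \<open>T F = F cof F = F T\<close>, which forces
  \<open>T i = T m\<close> if \<open>F i m \<noteq> 0\<close>; the remaining case follows by continuity.\<close>

theorem cramer_rule:
  assumes "finite V" "hermitian F" "i \<in> V" "l \<in> V"
  shows "cramer V F i (\<lambda>a. F a l) = (if i = l then det_on V F else 0)"
  using assms
proof (induction V arbitrary: F i l rule: finite_psubset_induct)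
  case (psubset V)
  define T where "T = (\<lambda>F i. cramer V F i (\<lambda>a. F a i))"
  \<comment> \<open>In the recursion along row \<open>i\<close> the induction hypothesis leaves only
    \<open>j = l\<close>; the two remaining terms cancel because the smaller determinant is
    real.\<close>
  have off: "cramer V F i (\<lambda>a. F a l) = 0" if F: "hermitian F" and il: "i \<in> V" "l \<in> V" "i \<noteq> l" for F i l
  proof -
    let ?W = "V - {i}"
    have "cramer ?W F j (\<lambda>a. F a l) = (if j = l then det_on ?W F else 0)" if "j \<in> ?W" for j
      by (rule psubset.IH) (use F il that in auto)
    then have "(\<Sum>j\<in>?W. F i j * cramer ?W F j (\<lambda>a. F a l)) = (\<Sum>j\<in>?W. if j = l then F i l * det_on ?W F else 0)"
      by (intro sum.cong) auto
    also have "\<dots> = F i l * det_on ?W F" using il psubset(1) by simp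
    also have "\<dots> = det_on ?W F * F i l"
      using real_quat_commute[OF det_on_real[OF _ F, of ?W]] psubset(1) by simp
    finally show ?thesis
      unfolding cramer_recursion[OF psubset(1) F il(1)] by simp
  qed
  have L: "(\<Sum>k\<in>V. cof V F i k * F k l) = (if i = l then T F i else 0)"
    if F: "hermitian F" and il: "i \<in> V" "l \<in> V" for F i l
    unfolding cramer_eq_sum[OF psubset(1) F il(1), symmetric] using off[OF F il] T_def by simp
  have real: "qcnj (T F i) = T F i" if F: "hermitian F" and i: "i \<in> V" for F i
  proof -
    let ?W = "V - {i}"
    have f: "finite ?W" using psubset(1) by auto
    have e: "T F i = det_on ?W F * F i i - (\<Sum>j\<in>?W. \<Sum>k\<in>?W. F i j * cof ?W F j k * F k i)"
      unfolding T_def cramer_recursion[OF psubset(1) F i]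
      by (simp add: cramer_eq_sum[OF f F] sum_distrib_left mult.assoc del: sum_subtractf)
    have "qcnj (\<Sum>j\<in>?W. \<Sum>k\<in>?W. F i j * cof ?W F j k * F k i) =
        (\<Sum>j\<in>?W. \<Sum>k\<in>?W. F i k * cof ?W F k j * F j i)"
      by (simp add: cof_sym[OF f F] hermitianD[OF F] mult.assoc)
    also have "\<dots> = (\<Sum>j\<in>?W. \<Sum>k\<in>?W. F i j * cof ?W F j k * F k i)"
      by (rule sum.swap)
    finally show ?thesis
      unfolding e using real_quat_commute[OF det_on_real[OF f F], of "F i i"]
      by (simp add: det_on_real[OF f F] hermitianD[OF F])
  qed
  have R: "(\<Sum>k\<in>V. F l k * cof V F k i) = (if i = l then T F i else 0)"
    if F: "hermitian F" and il: "i \<in> V" "l \<in> V" for F i l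
  proof -
    have "(\<Sum>k\<in>V. F l k * cof V F k i) = qcnj (\<Sum>k\<in>V. cof V F i k * F k l)"
      using il by (simp add: cof_sym[OF psubset(1) F] hermitianD[OF F])
    then show ?thesis using L[OF F il] real[OF F il(2)] by simp
  qed
  have conn: "T F i = T F m" if F: "hermitian F" and im: "i \<in> V" "m \<in> V" and nz: "F i m \<noteq> 0" for F i m
  proof -
    have "T F i * F i m = (\<Sum>l\<in>V. if l = i then T F i * F i m else 0)"
      using im psubset(1) by simp
    also have "\<dots> = (\<Sum>l\<in>V. (\<Sum>k\<in>V. F i k * cof V F k l) * F l m)"
      using im by (intro sum.cong) (auto simp: R[OF F])
    also have "\<dots> = (\<Sum>k\<in>V. \<Sum>l\<in>V. F i k * cof V F k l * F l m)"
      unfolding sum_distrib_right by (rule sum.swap)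
    also have "\<dots> = (\<Sum>k\<in>V. F i k * (\<Sum>l\<in>V. cof V F k l * F l m))"
      by (simp add: sum_distrib_left mult.assoc)
    also have "\<dots> = (\<Sum>k\<in>V. if k = m then F i m * T F m else 0)"
      using im by (intro sum.cong) (auto simp: L[OF F])
    also have "\<dots> = F i m * T F m" using im psubset(1) by simp
    also have "\<dots> = T F m * F i m" using real_quat_commute[OF real[OF F im(2)]] by simp
    finally have "(T F i - T F m) * F i m = 0" by (simp add: left_diff_distrib)
    then show ?thesis using nz by simp
  qed
  have all: "T F i = T F m" if F: "hermitian F" and im: "i \<in> V" "m \<in> V" for F i m
  proof (cases "F i m = 0 \<and> i \<noteq> m")
    case True
    \<comment> \<open>A real parameter in the places \<open>(i, m)\<close> and \<open>(m, i)\<close>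
      keeps the matrix Hermitian; for \<open>t \<noteq> 0\<close> the entry is nonzero, and
      \<open>t = 0\<close> gives back \<open>F\<close>.\<close>
    define G where "G = (\<lambda>t a c. if (a, c) = (i, m) \<or> (a, c) = (m, i) then Quat t 0 0 0 else F a c)"
    have G: "hermitian (G t)" for t
      unfolding hermitian_def G_def by (auto simp: hermitianD[OF F] quat_eq_iff[of "Quat _ _ _ _"])
    have Gc: "qcont (\<lambda>t. G t a c)" for a c

    proof (cases "(a, c) = (i, m) \<or> (a, c) = (m, i)")
      case True
      have "qcont (\<lambda>t. Quat t 0 0 0)" by (simp add: qcont_def)
      with True show ?thesis by (simp only: G_def if_True)
    next
      case False
      then show ?thesis by (simp only: G_def if_False qcont_const)
    qed
    have cont: "qcont (\<lambda>t. T (G t) j)" if "j \<in> V" for j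
      using qcont_cof_det[OF psubset(1) G Gc] that
      by (auto simp: T_def cramer_eq_sum[OF psubset(1) G that] intro!: qcont_intros Gc)
    have ne: "T (G t) i = T (G t) m" if "t \<noteq> 0" for t
      by (rule conn[OF G im]) (use that in \<open>auto simp: G_def zero_quat_def\<close>)
    have "T (G 0) i = T (G 0) m"
      by (rule qcont_eqI[OF cont[OF im(1)] cont[OF im(2)] ne])
    moreover have "G 0 = F"
      using True hermitianD[OF F, of i m] unfolding G_def by (auto simp: fun_eq_iff zero_quat_def[symmetric])
    ultimately show ?thesis by simp
  qed (use conn[OF F im] in auto)
  \<comment> \<open>At the least vertex \<open>T\<close> is \<open>det_on\<close> by the order of
    the cycles; \<open>all\<close> carries this to the other vertices.\<close>
  have "T F i = det_on V F" if "hermitian F" "i \<in> V" for F i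
  proof -
    have "V \<noteq> {}" using that by auto
    then show ?thesis
      using all[OF that, of "Min V"] psubset(1) det_on_eq_cramer[of V F] by (simp add: T_def)
  qed
  then show ?case using psubset.prems off T_def by auto
qed

lemma cof_mult:
  assumes "finite V" "hermitian F" "i \<in> V" "l \<in> V"
  shows "(\<Sum>k\<in>V. cof V F i k * F k l) = (if i = l then det_on V F else 0)"
  using cramer_rule[OF assms] cramer_eq_sum[OF assms(1-3), of "\<lambda>a. F a l"] by simp

lemma mult_cof:
  assumes "finite V" "hermitian F" "i \<in> V" "l \<in> V"
  shows "(\<Sum>k\<in>V. F i k * cof V F k l) = (if i = l then det_on V F else 0)"
proof -
  have "(\<Sum>k\<in>V. F i k * cof V F k l) = qcnj (\<Sum>k\<in>V. cof V F l k * F k i)"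
    using assms by (simp add: cof_sym hermitianD)
  then show ?thesis using assms by (simp add: cof_mult det_on_real)
qed

section \<open>Gram matrices and rank\<close>

text \<open>\<open>ctr A * A\<close> as a total function, since \<open>hermitian\<close> asks for
  symmetry at all indices, also beyond the columns of \<open>A\<close>.\<close>

definition gram :: "quat mat \<Rightarrow> nat \<Rightarrow> nat \<Rightarrow> quat" where
  "gram A a c = (\<Sum>e<dim_row A. qcnj (A $$ (e, a)) * A $$ (e, c))"

lemma hermitian_gram: "hermitian (gram A)"
  by (simp add: hermitian_def gram_def)

lemma gram_quadratic:
  "(\<Sum>a\<in>V. qcnj (x a) * (\<Sum>k\<in>V. gram A a k * x k)) =
   (\<Sum>e<dim_row A. qcnj (\<Sum>k\<in>V. A $$ (e, k) * x k) * (\<Sum>k\<in>V. A $$ (e, k) * x k))"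
proof -
  have "(\<Sum>a\<in>V. qcnj (x a) * (\<Sum>k\<in>V. gram A a k * x k)) =
      (\<Sum>a\<in>V. \<Sum>k\<in>V. \<Sum>e<dim_row A. qcnj (A $$ (e, a) * x a) * (A $$ (e, k) * x k))"
    by (simp add: gram_def sum_distrib_left sum_distrib_right mult.assoc)
  also have "\<dots> = (\<Sum>a\<in>V. \<Sum>e<dim_row A. \<Sum>k\<in>V. qcnj (A $$ (e, a) * x a) * (A $$ (e, k) * x k))"
    by (intro sum.cong refl sum.swap)
  also have "\<dots> = (\<Sum>e<dim_row A. \<Sum>a\<in>V. \<Sum>k\<in>V. qcnj (A $$ (e, a) * x a) * (A $$ (e, k) * x k))"
    by (rule sum.swap)
  finally show ?thesis unfolding qcnj_sum sum_product .
qed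

text \<open>Let x be column \<open>i\<close> of the cofactors. \<open>gram A\<close> sends x to the
  determinant times a unit vector, so the quadratic form at x picks out the diagonal cofactor, which
  is the smaller minor; the same form is the squared norm of A x.\<close>

lemma cof_column_norm:
  assumes "finite V" "i \<in> V"
  shows "(\<Sum>e<dim_row A. qre (qcnj (\<Sum>k\<in>V. A $$ (e, k) * cof V (gram A) k i) * (\<Sum>k\<in>V. A $$ (e, k) * cof V (gram A) k i))) =
    qre (det_on (V - {i}) (gram A)) * qre (det_on V (gram A))"
proof -
  let ?F = "gram A"
  note H = hermitian_gram[of A]
  have "(\<Sum>e<dim_row A. qcnj (\<Sum>k\<in>V. A $$ (e, k) * cof V ?F k i) * (\<Sum>k\<in>V. A $$ (e, k) * cof V ?F k i)) =
      (\<Sum>a\<in>V. qcnj (cof V ?F a i) * (if a = i then det_on V ?F else 0))"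
    unfolding gram_quadratic[symmetric]
    by (intro sum.cong refl) (simp add: mult_cof[OF assms(1) H _ assms(2)])
  also have "\<dots> = det_on (V - {i}) ?F * det_on V ?F"
    using assms cof_sym[OF assms(1) H assms(2) assms(2)] cof_diag[OF assms(1) H assms(2)]
    by (simp add: if_distrib[of "\<lambda>x. _ * x"] cong: if_cong)
  finally have "qre (\<Sum>e<dim_row A. qcnj (\<Sum>k\<in>V. A $$ (e, k) * cof V ?F k i) * (\<Sum>k\<in>V. A $$ (e, k) * cof V ?F k i)) =
     qre (det_on (V - {i}) ?F * det_on V ?F)" by simp
  also have "\<dots> = qre (det_on (V - {i}) ?F) * qre (det_on V ?F)"
    using det_on_real[OF assms(1) H] by (simp add: quat_eq_iff)
  finally show ?thesis unfolding qre_sum .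
qed

lemma right_indep_cols_subset:
  assumes "right_indep_cols A V" "W \<subseteq> V" "finite V"
  shows "right_indep_cols A W"
  unfolding right_indep_cols_def
proof (intro allI impI ballI)
  fix x :: "nat \<Rightarrow> quat" and j
  assume x: "\<forall>a<dim_row A. (\<Sum>j\<in>W. A $$ (a, j) * x j) = 0" and j: "j \<in> W"
  let ?y = "\<lambda>j. if j \<in> W then x j else 0"
  have "(\<Sum>j\<in>V. A $$ (a, j) * ?y j) = (\<Sum>j\<in>W. A $$ (a, j) * x j)" for a
    by (rule sum.mono_neutral_cong_right) (use assms in auto)
  then have "\<forall>j\<in>V. ?y j = 0" using assms(1) x unfolding right_indep_cols_def by presburger
  then show "x j = 0" using j assms(2) by (metis subsetD)
qed

text \<open>Columns are added one at a time. The new cofactor column is nonzero, since its entry at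
  \<open>i\<close> is the previous minor; by independence its image under \<open>A\<close> is
  nonzero, and \<open>cof_column_norm\<close> makes the product of both minors positive.\<close>

lemma det_on_gram_pos:
  assumes "finite V" "right_indep_cols A V"
  shows "qre (det_on V (gram A)) > 0"
  using assms
proof (induction V rule: finite_induct)
  case (insert i W)
  let ?V = "insert i W" and ?F = "gram A"
  have W: "?V - {i} = W" using insert by auto
  have "right_indep_cols A W"
    by (rule right_indep_cols_subset[OF insert.prems]) (use insert.hyps in auto)
  then have pos: "qre (det_on W ?F) > 0" by (rule insert.IH)
  let ?y = "\<lambda>e. \<Sum>k\<in>?V. A $$ (e, k) * cof ?V ?F k i"
  have "cof ?V ?F i i = det_on W ?F"
    using cof_diag[of ?V ?F i] insert.hyps hermitian_gram W by simp
  then have "cof ?V ?F i i \<noteq> 0" using pos by auto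
  then obtain e where e: "e < dim_row A" "?y e \<noteq> 0"
    using insert.prems[unfolded right_indep_cols_def, THEN spec, of "\<lambda>k. cof ?V ?F k i"] by blast
  have "0 < qre (qcnj (?y e) * ?y e)" by (rule qre_norm(2)[OF e(2)])
  also have "\<dots> \<le> (\<Sum>e<dim_row A. qre (qcnj (?y e) * ?y e))"
    by (rule member_le_sum[where f = "\<lambda>e. qre (qcnj (?y e) * ?y e)"]) (use e qre_norm(1) in \<open>simp_all only: lessThan_iff finite_lessThan\<close>)
  also have "\<dots> = qre (det_on W ?F) * qre (det_on ?V ?F)"
    using cof_column_norm[of ?V i A] insert.hyps(1) unfolding W by simp
  finally show ?case using pos by (simp add: zero_less_mult_iff)
qed simp

text \<open>A relation among the columns is annihilated by \<open>gram A\<close>; multiplying by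
  cofactors turns it into the determinant times a nonzero coefficient.\<close>

lemma det_on_gram_eq_0:
  assumes "finite V" "\<not> right_indep_cols A V"
  shows "det_on V (gram A) = 0"
proof -
  let ?F = "gram A"
  obtain x j where x: "\<And>a. a < dim_row A \<Longrightarrow> (\<Sum>j\<in>V. A $$ (a, j) * x j) = 0" and j: "j \<in> V" "x j \<noteq> 0"
    using assms(2) unfolding right_indep_cols_def by blast
  have "(\<Sum>l\<in>V. ?F k l * x l) = (\<Sum>e<dim_row A. qcnj (A $$ (e, k)) * (\<Sum>l\<in>V. A $$ (e, l) * x l))" for k
    unfolding gram_def sum_distrib_left sum_distrib_right mult.assoc by (rule sum.swap)
  then have "(\<Sum>l\<in>V. ?F k l * x l) = 0" for k using x by simp
  then have "0 = (\<Sum>k\<in>V. cof V ?F j k * (\<Sum>l\<in>V. ?F k l * x l))" by simp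
  also have "\<dots> = (\<Sum>l\<in>V. (\<Sum>k\<in>V. cof V ?F j k * ?F k l) * x l)"
    unfolding sum_distrib_left sum_distrib_right mult.assoc by (rule sum.swap)
  also have "\<dots> = (\<Sum>l\<in>V. if l = j then det_on V ?F * x l else 0)"
    by (intro sum.cong refl) (simp add: cof_mult[OF assms(1) hermitian_gram j(1)])
  also have "\<dots> = det_on V ?F * x j" using assms(1) j(1) by simp
  finally show ?thesis using j(2) by simp
qed

text \<open>When the determinant vanishes, \<open>cof_column_norm\<close> is a vanishing sum of
  squares, so each cofactor column is a relation among the columns of \<open>A\<close>; conjugation
  gives the form stated.\<close>

lemma cof_mult_col_eq_0:
  assumes "finite V" "det_on V (gram A) = 0" "i \<in> V" "e < dim_row A"
  shows "(\<Sum>k\<in>V. cof V (gram A) i k * qcnj (A $$ (e, k))) = 0"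
proof -
  let ?y = "\<lambda>e. \<Sum>k\<in>V. A $$ (e, k) * cof V (gram A) k i"
  have "(\<Sum>e<dim_row A. qre (qcnj (?y e) * ?y e)) = 0"
    using cof_column_norm[OF assms(1,3), of A] assms(2) by simp
  then have "qre (qcnj (?y e) * ?y e) = 0"
    using assms(4) qre_norm(1)
      sum_nonneg_eq_0_iff[of "{..<dim_row A}" "\<lambda>e. qre (qcnj (?y e) * ?y e)"] by blast
  then have "?y e = 0" using qre_norm(2)[of "?y e"] by force
  then have "qcnj (?y e) = 0" by simp
  then show ?thesis using assms(3) by (simp add: cof_sym[OF assms(1) hermitian_gram])
qed

section \<open>Rank and maximal independent sets of columns\<close>

lemma qrank_indep:
  obtains J where "J \<subseteq> {0..<dim_col A}" "right_indep_cols A J" "card J = qrank A"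
proof -
  let ?S = "{card J | J. J \<subseteq> {0..<dim_col A} \<and> right_indep_cols A J}"
  have "?S \<subseteq> card ` Pow {0..<dim_col A}" by auto
  then have "finite ?S" by (rule finite_subset) simp
  moreover have "right_indep_cols A {}" by (simp add: right_indep_cols_def)
  then have "0 \<in> ?S" by force
  ultimately have "qrank A \<in> ?S" unfolding qrank_def by (intro Max_in) auto
  then show ?thesis using that by auto
qed

lemma card_le_qrank:
  assumes "J \<subseteq> {0..<dim_col A}" "right_indep_cols A J"
  shows "card J \<le> qrank A"
proof -
  let ?S = "{card J | J. J \<subseteq> {0..<dim_col A} \<and> right_indep_cols A J}"
  have "?S \<subseteq> card ` Pow {0..<dim_col A}" by auto
  then have "finite ?S" by (rule finite_subset) simp
  then show ?thesis unfolding qrank_def using assms by (intro Max_ge) auto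
qed

section \<open>Sums of principal minors and of cofactors\<close>

definition dets :: "nat \<Rightarrow> nat \<Rightarrow> (nat \<Rightarrow> nat \<Rightarrow> quat) \<Rightarrow> quat" where
  "dets n k F = (\<Sum>\<beta>\<in>Lk k n. det_on \<beta> F)"

definition cofs :: "nat \<Rightarrow> nat \<Rightarrow> (nat \<Rightarrow> nat \<Rightarrow> quat) \<Rightarrow> nat \<Rightarrow> nat \<Rightarrow> quat" where
  "cofs n k F i l = (\<Sum>\<beta>\<in>Lk k n. if i \<in> \<beta> \<and> l \<in> \<beta> then cof \<beta> F i l else 0)"

lemma finite_Lk [simp]: "finite (Lk k n)"
  unfolding Lk_def by (rule finite_subset[of _ "Pow {0..<n}"]) auto

lemma LkD: "\<beta> \<in> Lk k n \<Longrightarrow> finite \<beta>" "\<beta> \<in> Lk k n \<Longrightarrow> i \<in> \<beta> \<Longrightarrow> i < n"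
  unfolding Lk_def by (auto intro: finite_subset)

lemma dets_real: "hermitian F \<Longrightarrow> qcnj (dets n k F) = dets n k F"
  by (simp add: dets_def det_on_real LkD)

lemma cofs_sym: "hermitian F \<Longrightarrow> qcnj (cofs n k F i l) = cofs n k F l i"
  unfolding cofs_def qcnj_sum by (intro sum.cong refl) (auto simp: cof_sym LkD)

text \<open>Only sets containing \<open>l\<close> contribute; removing \<open>l\<close> from them
  yields the \<open>k\<close>-sets without \<open>l\<close>. Off the diagonal, expanding the
  cofactor along column \<open>l\<close> leaves a Cramer numerator with that column as right-hand
  side.\<close>

lemma cofs_Suc:
  assumes "hermitian F" "l < n"
  shows "cofs n (Suc k) F i l = (\<Sum>\<beta>\<in>Lk k n. if l \<in> \<beta> then 0 else if i = l then det_on \<beta> F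
    else if i \<in> \<beta> then - cramer \<beta> F i (\<lambda>a. F a l) else 0)" (is "_ = sum ?g _")
proof -
  have "cofs n (Suc k) F i l = (\<Sum>\<gamma>\<in>{\<gamma>\<in>Lk (Suc k) n. l \<in> \<gamma>}. if i \<in> \<gamma> then cof \<gamma> F i l else 0)"
    unfolding cofs_def by (rule sum.mono_neutral_cong_right) auto
  also have "\<dots> = (\<Sum>\<beta>\<in>{\<beta>\<in>Lk k n. l \<notin> \<beta>}. if i \<in> insert l \<beta> then cof (insert l \<beta>) F i l else 0)"
    by (rule sum.reindex_bij_witness[where i = "insert l" and j = "\<lambda>\<gamma>. \<gamma> - {l}"])
      (use assms(2) in \<open>auto simp: Lk_def insert_absorb finite_subset[of _ "{0..<n}"]\<close>)
  also have "\<dots> = sum ?g {\<beta>\<in>Lk k n. l \<notin> \<beta>}"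
  proof (rule sum.cong[OF refl], clarify)
    fix \<beta> assume \<beta>: "\<beta> \<in> Lk k n" "l \<notin> \<beta>"
    have fin: "finite (insert l \<beta>)" using \<beta> LkD by simp
    have rest: "insert l \<beta> - {l} = \<beta>" using \<beta> by auto
    have "cof (insert l \<beta>) F i l = - cramer \<beta> F i (\<lambda>a. F a l)" if i: "i \<in> \<beta>"
    proof -
      have "cof (insert l \<beta>) F i l = qcnj (cof (insert l \<beta>) F l i)"
        using i by (simp add: cof_sym[OF fin assms(1)])
      also have "\<dots> = - (\<Sum>j\<in>\<beta>. cof \<beta> F i j * F j l)"
        using i \<beta>(2) rest cof_off_diag[OF fin assms(1), of l i]
        by (cases "l = i") (auto simp: cof_sym[OF LkD(1)[OF \<beta>(1)] assms(1)] hermitianD[OF assms(1)] simp del: Diff_insert0)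
      finally show ?thesis using cramer_eq_sum[OF LkD(1)[OF \<beta>(1)] assms(1) i] by simp
    qed
    then show "(if i \<in> insert l \<beta> then cof (insert l \<beta>) F i l else 0) = ?g \<beta>"
      using \<beta> cof_diag[OF fin assms(1), of l] rest by auto
  qed
  also have "\<dots> = sum ?g (Lk k n)" by (rule sum.mono_neutral_left) auto
  finally show ?thesis .
qed

text \<open>The coefficients of the identity \<open>adj (t + F) (t + F) = det (t + F)\<close> in powers of \<open>t\<close>.\<close>

lemma cofs_recursion:
  assumes "hermitian F" "i < n" "l < n"
  shows "cofs n (Suc k) F i l + (\<Sum>j<n. cofs n k F i j * F j l) = (if i = l then dets n k F else 0)"
proof -
  have "(\<Sum>j<n. cofs n k F i j * F j l) =
      (\<Sum>\<beta>\<in>Lk k n. \<Sum>j<n. (if i \<in> \<beta> \<and> j \<in> \<beta> then cof \<beta> F i j else 0) * F j l)"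
    unfolding cofs_def sum_distrib_right by (rule sum.swap)
  also have "\<dots> = (\<Sum>\<beta>\<in>Lk k n. if i \<in> \<beta> then cramer \<beta> F i (\<lambda>a. F a l) else 0)"
  proof (rule sum.cong[OF refl])
    fix \<beta> assume \<beta>: "\<beta> \<in> Lk k n"
    have "(\<Sum>j<n. (if i \<in> \<beta> \<and> j \<in> \<beta> then cof \<beta> F i j else 0) * F j l) =
        (\<Sum>j\<in>\<beta>. (if i \<in> \<beta> then cof \<beta> F i j else 0) * F j l)"
      by (rule sum.mono_neutral_cong_right) (use LkD[OF \<beta>] in auto)
    also have "\<dots> = (if i \<in> \<beta> then cramer \<beta> F i (\<lambda>a. F a l) else 0)"
      using cramer_eq_sum[OF LkD(1)[OF \<beta>] assms(1)] by simp
    finally show "(\<Sum>j<n. (if i \<in> \<beta> \<and> j \<in> \<beta> then cof \<beta> F i j else 0) * F j l) =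
      (if i \<in> \<beta> then cramer \<beta> F i (\<lambda>a. F a l) else 0)" .
  qed
  finally show ?thesis
    \<comment> \<open>For fixed \<open>\<beta>\<close>: if \<open>l \<in> \<beta>\<close>, the first
      term is 0 and Cramer's rule evaluates the second; otherwise the two terms cancel, except that
      for \<open>i = l\<close> the first is the determinant and the second 0.\<close>
    unfolding cofs_Suc[OF assms(1,3)] sum.distrib[symmetric] dets_def
    by (simp only: sum.distrib[symmetric])
      (auto intro!: sum.cong sum.neutral simp: cramer_rule[OF LkD(1) assms(1)])
qed

text \<open>Each minor of size \<open>k\<close> is counted once for every index outside it.\<close>

lemma cofs_trace:
  assumes "hermitian F"
  shows "(\<Sum>i<n. cofs n (Suc k) F i i) = of_nat (n - k) * dets n k F"
proof -
  have "(\<Sum>i<n. cofs n (Suc k) F i i) = (\<Sum>i<n. \<Sum>\<beta>\<in>Lk k n. if i \<in> \<beta> then 0 else det_on \<beta> F)"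
    by (auto simp: cofs_Suc[OF assms] intro!: sum.cong)
  also have "\<dots> = (\<Sum>\<beta>\<in>Lk k n. \<Sum>i<n. if i \<in> \<beta> then 0 else det_on \<beta> F)"
    by (rule sum.swap)
  also have "\<dots> = (\<Sum>\<beta>\<in>Lk k n. of_nat (n - k) * det_on \<beta> F)"
  proof (rule sum.cong[OF refl])
    fix \<beta> assume \<beta>: "\<beta> \<in> Lk k n"
    then have "card ({..<n} - \<beta>) = n - k"
      by (subst card_Diff_subset) (auto simp: Lk_def lessThan_atLeast0 finite_subset)
    moreover have "(\<Sum>i<n. if i \<in> \<beta> then 0 else det_on \<beta> F) = (\<Sum>i\<in>{..<n} - \<beta>. det_on \<beta> F)"
      by (rule sum.mono_neutral_cong_right) auto
    ultimately show "(\<Sum>i<n. if i \<in> \<beta> then 0 else det_on \<beta> F) = of_nat (n - k) * det_on \<beta> F" by simp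
  qed
  finally show ?thesis by (simp add: dets_def sum_distrib_left)
qed

text \<open>No principal minor is negative, and an independent set of maximal size contributes a
  positive one.\<close>

lemma dets_gram_pos:
  "qre (dets (dim_col A) (qrank A) (gram A)) > 0"
proof -
  obtain J where J: "J \<subseteq> {0..<dim_col A}" "right_indep_cols A J" "card J = qrank A"
    by (rule qrank_indep)
  then have JL: "J \<in> Lk (qrank A) (dim_col A)" by (simp add: Lk_def)
  have nn: "qre (det_on \<beta> (gram A)) \<ge> 0" if "\<beta> \<in> Lk k n" for \<beta> k n
    using det_on_gram_pos[of \<beta> A] det_on_gram_eq_0[of \<beta> A] LkD(1)[OF that] by force
  have "0 < qre (det_on J (gram A))" using det_on_gram_pos LkD(1)[OF JL] J by blast
  also have "\<dots> \<le> (\<Sum>\<beta>\<in>Lk (qrank A) (dim_col A). qre (det_on \<beta> (gram A)))"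
    using JL nn by (intro member_le_sum[where f = "\<lambda>\<beta>. qre (det_on \<beta> (gram A))"]) auto
  finally show ?thesis unfolding dets_def qre_sum .
qed

lemma cofs_gram_annihilates:
  assumes "e < dim_row A"
  shows "(\<Sum>j<dim_col A. cofs (dim_col A) (Suc (qrank A)) (gram A) i j * qcnj (A $$ (e, j))) = 0"
proof -
  let ?n = "dim_col A" and ?k = "Suc (qrank A)" and ?F = "gram A"
  have "(\<Sum>j<?n. cofs ?n ?k ?F i j * qcnj (A $$ (e, j))) =
      (\<Sum>\<beta>\<in>Lk ?k ?n. \<Sum>j<?n. (if i \<in> \<beta> \<and> j \<in> \<beta> then cof \<beta> ?F i j else 0) * qcnj (A $$ (e, j)))"
    unfolding cofs_def sum_distrib_right by (rule sum.swap)
  also have "\<dots> = 0"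
  proof (rule sum.neutral, clarify)
    fix \<beta> assume \<beta>: "\<beta> \<in> Lk ?k ?n"
    then have "\<not> right_indep_cols A \<beta>"
      using card_le_qrank[of \<beta> A] by (auto simp: Lk_def)
    then have 0: "det_on \<beta> ?F = 0" using det_on_gram_eq_0 LkD(1)[OF \<beta>] by blast
    have "(\<Sum>j<?n. (if i \<in> \<beta> \<and> j \<in> \<beta> then cof \<beta> ?F i j else 0) * qcnj (A $$ (e, j))) =
        (\<Sum>j\<in>\<beta>. (if i \<in> \<beta> then cof \<beta> ?F i j else 0) * qcnj (A $$ (e, j)))"
      by (rule sum.mono_neutral_cong_right) (use LkD[OF \<beta>] in auto)
    also have "\<dots> = 0"
      using cof_mult_col_eq_0[OF LkD(1)[OF \<beta>] 0 _ assms] by (cases "i \<in> \<beta>") auto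
    finally show "(\<Sum>j<?n. (if i \<in> \<beta> \<and> j \<in> \<beta> then cof \<beta> ?F i j else 0) * qcnj (A $$ (e, j))) = 0" .
  qed
  finally show ?thesis .
qed

section \<open>Column and row determinants of submatrices\<close>

lemma sorted_list_of_set_image:
  fixes h :: "nat \<Rightarrow> nat"
  assumes "finite S" "\<And>x y. x \<in> S \<Longrightarrow> y \<in> S \<Longrightarrow> x < y \<Longrightarrow> h x < h y"
  shows "sorted_list_of_set (h ` S) = map h (sorted_list_of_set S)"
proof -
  have inj: "inj_on h S"
    by (rule inj_onI) (metis assms(2) less_irrefl linorder_neqE_nat)
  have "sorted_wrt (<) (map h (sorted_list_of_set S))"
    unfolding sorted_wrt_map
    by (rule sorted_wrt_mono_rel[OF _ strict_sorted_list_of_set]) (use assms in auto)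
  then have "sorted_wrt (<) (map h (sorted_list_of_set S)) \<and> set (map h (sorted_list_of_set S)) = h ` S \<and>
      length (map h (sorted_list_of_set S)) = card (h ` S)"
    using assms(1) by (simp add: card_image[OF inj])
  then show ?thesis using sorted_list_of_set_unique[of "h ` S"] assms(1) by blast
qed

section \<open>Relabelling along an order isomorphism\<close>

context
  fixes h :: "nat \<Rightarrow> nat" and n :: nat and V :: "nat set" and \<sigma> \<tau> :: "nat \<Rightarrow> nat"
  assumes h: "bij_betw h {0..<n} V" "\<And>x y. y < n \<Longrightarrow> x < y \<Longrightarrow> h x < h y"
    and \<sigma>: "\<sigma> permutes {0..<n}"
    and \<tau>_def: "\<tau> = (\<lambda>x. if x \<in> V then h (\<sigma> (inv_into {0..<n} h x)) else x)"
begin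

lemma relabel_funpow: "a < n \<Longrightarrow> (\<tau> ^^ k) (h a) = h ((\<sigma> ^^ k) a)"
proof (induction k)
  case (Suc k)
  have "(\<sigma> ^^ k) a \<in> {0..<n}" using funpow_in[OF \<sigma>, of a] Suc.prems by simp
  then show ?case
    using Suc h(1) by (auto simp: \<tau>_def bij_betw_inv_into_left dest: bij_betwE)
qed simp

lemma relabel_eq_iff: "a < n \<Longrightarrow> b < n \<Longrightarrow> h a = h b \<longleftrightarrow> a = b"
  by (metis h(2) less_irrefl linorder_neqE_nat)

lemma relabel_le_iff: "a < n \<Longrightarrow> b < n \<Longrightarrow> h a \<le> h b \<longleftrightarrow> a \<le> b"
  by (metis h(2) linorder_not_less nle_le order_le_less)

lemma relabel_range: "a < n \<Longrightarrow> (\<sigma> ^^ k) a < n"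
  using funpow_in[OF \<sigma>, of a k] by simp

lemma relabel_image: "V = h ` {0..<n}"
  using h(1) by (simp add: bij_betw_def)

lemma relabel_cyc_len: "a < n \<Longrightarrow> cyc_len \<tau> (h a) = cyc_len \<sigma> a"
  unfolding cyc_len_def by (simp add: relabel_funpow relabel_eq_iff relabel_range)

lemma relabel_cycle_prod:
  assumes "a < n" "\<And>x y. x < n \<Longrightarrow> y < n \<Longrightarrow> M $$ (x, y) = F (h x) (h y)"
  shows "cycle_prod F \<tau> (h a) = cyc_prod M \<sigma> a"
  unfolding cycle_prod_def cyc_prod_def relabel_cyc_len[OF assms(1)] relabel_funpow[OF assms(1)]
  using assms by (simp add: relabel_range del: funpow.simps)

text \<open>Leaders are least elements of orbits, so a mere bijection would not do: \<open>h\<close>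
  has to preserve the order.\<close>

lemma relabel_leaders: "leaders V \<tau> = h ` cyc_leaders n \<sigma>"
  unfolding leaders_def cyc_leaders_def relabel_image
  by (auto simp: relabel_funpow relabel_le_iff relabel_range)

lemma relabel_leaders_off: "i < n \<Longrightarrow> leaders_off V \<tau> (h i) = h ` other_leaders n \<sigma> i"
  unfolding leaders_off_def other_leaders_def relabel_leaders
  by (auto simp: relabel_funpow relabel_eq_iff relabel_range cyc_leaders_def)

end

text \<open>The order of the noncommuting factors is that of the leaders; an increasing
  \<open>h\<close> carries the sorted list of leaders to the sorted list of their images.\<close>

lemma cdet_eq_cdet_on:
  assumes h: "bij_betw h {0..<n} V" "\<And>x y. y < n \<Longrightarrow> x < y \<Longrightarrow> h x < h y"
    and M: "dim_row M = n" "\<And>x y. x < n \<Longrightarrow> y < n \<Longrightarrow> M $$ (x, y) = F (h x) (h y)" and i: "i < n"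
  shows "cdet i M = cdet_on V (h i) 1 F"
proof -
  let ?t = "\<lambda>\<sigma> x. if x \<in> V then h (\<sigma> (inv_into {0..<n} h x)) else x"
  have inj: "inj_on h {0..<n}" and card: "card V = n"
    using h(1) bij_betw_same_card[OF h(1)] by (auto simp: bij_betw_def)
  show ?thesis
    unfolding cdet_def cdet_on_def Let_def M(1)
      sum.reindex_bij_betw[OF bij_betw_permutations[OF h(1)], symmetric]
  proof (rule sum.cong[OF refl], clarify)
    fix \<sigma> assume \<sigma>: "\<sigma> permutes {0..<n}"
    have L: "leaders V (?t \<sigma>) = h ` cyc_leaders n \<sigma>"
      by (rule relabel_leaders[OF h \<sigma> refl])
    have LO: "leaders_off V (?t \<sigma>) (h i) = h ` other_leaders n \<sigma> i"
      by (rule relabel_leaders_off[OF h \<sigma> refl i])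
    have C: "cycle_prod F (?t \<sigma>) (h a) = cyc_prod M \<sigma> a" if "a < n" for a
      by (rule relabel_cycle_prod[OF h \<sigma> refl that M(2)])
    have sub: "other_leaders n \<sigma> i \<subseteq> cyc_leaders n \<sigma>" "cyc_leaders n \<sigma> \<subseteq> {0..<n}"
      by (auto simp: cyc_leaders_def other_leaders_def)
    then have fin: "finite (other_leaders n \<sigma> i)" by (meson finite_atLeastLessThan finite_subset)
    have 1: "card (leaders V (?t \<sigma>)) = card (cyc_leaders n \<sigma>)"
      unfolding L by (rule card_image[OF inj_on_subset[OF inj sub(2)]])
    have 2: "sorted_list_of_set (leaders_off V (?t \<sigma>) (h i)) = map h (sorted_list_of_set (other_leaders n \<sigma> i))"
      unfolding LO using sub by (intro sorted_list_of_set_image fin h(2)) auto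
    have 3: "map (cycle_prod F (?t \<sigma>)) (rev (map h (sorted_list_of_set (other_leaders n \<sigma> i)))) =
        map (cyc_prod M \<sigma>) (rev (sorted_list_of_set (other_leaders n \<sigma> i)))"
      unfolding rev_map map_map o_def
      by (rule map_cong[OF refl], rule C) (use fin sub in auto)
    show "(- 1) ^ (n - card (cyc_leaders n \<sigma>)) *
       (prod_list (map (cyc_prod M \<sigma>) (rev (sorted_list_of_set (other_leaders n \<sigma> i)))) * cyc_prod M \<sigma> i) =
      (- 1) ^ (card V - card (leaders V (?t \<sigma>))) *
       (prod_list (map (cycle_prod F (?t \<sigma>)) (rev (sorted_list_of_set (leaders_off V (?t \<sigma>) (h i))))) *
        (1 * cycle_prod F (?t \<sigma>) (h i)))"
      unfolding 1 2 3 card C[OF i] by simp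
  qed
qed

lemma
  assumes "finite \<beta>"
  shows bij_betw_nth_sorted: "bij_betw (\<lambda>a. sorted_list_of_set \<beta> ! a) {0..<card \<beta>} \<beta>"
    and nth_sorted_less: "y < card \<beta> \<Longrightarrow> x < y \<Longrightarrow> sorted_list_of_set \<beta> ! x < sorted_list_of_set \<beta> ! y"
proof -
  show "bij_betw (\<lambda>a. sorted_list_of_set \<beta> ! a) {0..<card \<beta>} \<beta>"
    using assms by (intro bij_betw_nth) auto
  show "y < card \<beta> \<Longrightarrow> x < y \<Longrightarrow> sorted_list_of_set \<beta> ! x < sorted_list_of_set \<beta> ! y"
    using sorted_wrt_nth_less[OF strict_sorted_list_of_set[of \<beta>]] assms by simp
qed

lemma nth_sorted_pos_in:
  assumes "finite \<beta>" "i \<in> \<beta>"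
  shows "pos_in \<beta> i < card \<beta>" "sorted_list_of_set \<beta> ! pos_in \<beta> i = i"
proof -
  let ?h = "\<lambda>a. sorted_list_of_set \<beta> ! a"
  note b = bij_betw_nth_sorted[OF assms(1)] and less = nth_sorted_less[OF assms(1)]
  obtain p where p: "p < card \<beta>" "?h p = i"
    using b assms(2) unfolding bij_betw_def by (metis atLeastLessThan_iff imageE)
  have iff: "?h a < i \<longleftrightarrow> a < p" if "a < card \<beta>" for a
    using less[OF p(1), of a] less[OF that, of p] p(2) by (metis linorder_neqE_nat order_less_asym)
  have "{x \<in> \<beta>. x < i} = ?h ` {0..<p}"
  proof -
    have "{x \<in> ?h ` {0..<card \<beta>}. x < i} = ?h ` {0..<p}" using iff p(1) by force
    then show ?thesis using b by (simp add: bij_betw_def)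
  qed
  moreover have "inj_on ?h {0..<p}"
    using b p(1) by (auto simp: bij_betw_def intro: inj_on_subset)
  ultimately have "pos_in \<beta> i = p" by (simp add: pos_in_def card_image)
  then show "pos_in \<beta> i < card \<beta>" "sorted_list_of_set \<beta> ! pos_in \<beta> i = i" using p by auto
qed

lemma cdet_psub:
  assumes "finite \<beta>" "i \<in> \<beta>" "\<And>a c. a \<in> \<beta> \<Longrightarrow> c \<in> \<beta> \<Longrightarrow> G $$ (a, c) = F a c"
  shows "cdet (pos_in \<beta> i) (psub G \<beta>) = cdet_on \<beta> i 1 F"
proof -
  let ?h = "\<lambda>a. sorted_list_of_set \<beta> ! a"
  note b = bij_betw_nth_sorted[OF assms(1)]
  note p = nth_sorted_pos_in[OF assms(1,2)]
  have "?h x \<in> \<beta>" if "x < card \<beta>" for x using b that by (auto simp: bij_betw_def)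
  then have "cdet (pos_in \<beta> i) (psub G \<beta>) = cdet_on \<beta> (?h (pos_in \<beta> i)) 1 F"
    by (intro cdet_eq_cdet_on[OF b nth_sorted_less[OF assms(1)]]) (auto simp: psub_def p assms(3))
  then show ?thesis using p by simp
qed

lemma cdet_sub_eq_cramer:
  assumes "G \<in> carrier_mat n n" "\<And>a c. a < n \<Longrightarrow> c < n \<Longrightarrow> G $$ (a, c) = F a c"
    and "\<beta> \<in> Lk k n" "i \<in> \<beta>"
  shows "cdet_sub G i b \<beta> = cramer \<beta> F i (\<lambda>a. b $ a)"
  unfolding cdet_sub_def cramer_def
  by (rule cdet_psub[OF LkD(1)[OF assms(3)] assms(4)])
    (use assms(1,2) LkD(2)[OF assms(3)] in \<open>auto simp: col_repl_def repl_col_def\<close>)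

section \<open>Inverse permutations and conjugate transposition\<close>

lemma inv_funpow_eq_iff:
  fixes \<sigma> :: "nat \<Rightarrow> nat"
  assumes "\<sigma> permutes S"
  shows "(inv_into UNIV \<sigma> ^^ k) x = y \<longleftrightarrow> (\<sigma> ^^ k) y = x"
proof (induction k arbitrary: y)
  case (Suc k)
  have "(inv_into UNIV \<sigma> ^^ Suc k) x = y \<longleftrightarrow> (inv_into UNIV \<sigma> ^^ k) x = \<sigma> y"
    using permutes_inverses[OF assms] by auto
  then show ?case using Suc[of "\<sigma> y"] by (simp add: funpow_swap1)
qed auto

lemma
  fixes \<sigma> :: "nat \<Rightarrow> nat"
  assumes \<sigma>: "\<sigma> permutes {0..<n}"
  shows cyc_len_inv: "cyc_len (inv_into UNIV \<sigma>) x = cyc_len \<sigma> x"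
    and cyc_leaders_inv: "cyc_leaders n (inv_into UNIV \<sigma>) = cyc_leaders n \<sigma>"
    and other_leaders_inv: "other_leaders n (inv_into UNIV \<sigma>) i = other_leaders n \<sigma> i"
proof -
  have orbit: "(\<exists>k. (inv_into UNIV \<sigma> ^^ k) x = y) \<longleftrightarrow> (\<exists>k. (\<sigma> ^^ k) x = y)" for x y
    unfolding inv_funpow_eq_iff[OF \<sigma>] using funpow_orbit_sym[OF \<sigma>] by blast
  show "cyc_len (inv_into UNIV \<sigma>) x = cyc_len \<sigma> x"
    by (simp add: cyc_len_def inv_funpow_eq_iff[OF \<sigma>])
  have "(\<forall>k. x \<le> (inv_into UNIV \<sigma> ^^ k) x) \<longleftrightarrow> (\<forall>k. x \<le> (\<sigma> ^^ k) x)" for x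
    using orbit[of x] by metis
  then show *: "cyc_leaders n (inv_into UNIV \<sigma>) = cyc_leaders n \<sigma>" by (simp add: cyc_leaders_def)
  show "other_leaders n (inv_into UNIV \<sigma>) i = other_leaders n \<sigma> i"
    using orbit[of i] by (auto simp: other_leaders_def *)
qed

text \<open>The inverse runs through the cycle backwards, \<open>ctr\<close> swaps the two indices
  of each entry, and conjugation reverses the product; together these reversals cancel.\<close>

lemma cyc_prod_inv_ctr:
  assumes \<sigma>: "\<sigma> permutes {0..<n}" and F: "F \<in> carrier_mat n n" and c: "c < n"
  shows "qcnj (cyc_prod (ctr F) (inv_into UNIV \<sigma>) c) = cyc_prod F \<sigma> c"
proof -
  let ?L = "cyc_len \<sigma> c"
  \<comment> \<open>Going \<open>k\<close> steps back on a cycle of length \<open>?L\<close> is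
    going \<open>?L - k\<close> steps forward.\<close>
  have inv: "(inv_into UNIV \<sigma> ^^ k) c = (\<sigma> ^^ (?L - k)) c" if "k \<le> ?L" for k
  proof -
    have "(\<sigma> ^^ k) ((\<sigma> ^^ (?L - k)) c) = (\<sigma> ^^ (k + (?L - k))) c" by (simp only: funpow_add o_apply)
    then show ?thesis
      unfolding inv_funpow_eq_iff[OF \<sigma>] using that cyc_len(2)[OF \<sigma>] by simp
  qed
  have lt: "(\<sigma> ^^ k) c < n" for k using funpow_in[OF \<sigma>, of c k] c by simp
  have "map qcnj (rev (map (\<lambda>k. ctr F $$ ((inv_into UNIV \<sigma> ^^ k) c, (inv_into UNIV \<sigma> ^^ Suc k) c)) [0..<?L])) =
      map (\<lambda>k. F $$ ((\<sigma> ^^ k) c, (\<sigma> ^^ Suc k) c)) [0..<?L]"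
  proof (rule nth_equalityI)
    fix k assume "k < length (map qcnj (rev (map (\<lambda>k. ctr F $$ ((inv_into UNIV \<sigma> ^^ k) c, (inv_into UNIV \<sigma> ^^ Suc k) c)) [0..<?L])))"
    then have k: "k < ?L" by simp
    then have e: "?L - (?L - Suc k) = Suc k" "?L - Suc (?L - Suc k) = k" by auto
    have "map qcnj (rev (map (\<lambda>k. ctr F $$ ((inv_into UNIV \<sigma> ^^ k) c, (inv_into UNIV \<sigma> ^^ Suc k) c)) [0..<?L])) ! k
      = qcnj (ctr F $$ ((inv_into UNIV \<sigma> ^^ (?L - Suc k)) c, (inv_into UNIV \<sigma> ^^ Suc (?L - Suc k)) c))"
      using k by (simp add: rev_nth del: funpow.simps)
    also have "\<dots> = qcnj (ctr F $$ ((\<sigma> ^^ Suc k) c, (\<sigma> ^^ k) c))"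
      using k by (subst (1 2) inv) (auto simp only: e)
    also have "\<dots> = F $$ ((\<sigma> ^^ k) c, (\<sigma> ^^ Suc k) c)"
      using F lt by (simp add: ctr_def del: funpow.simps)
    finally show "map qcnj (rev (map (\<lambda>k. ctr F $$ ((inv_into UNIV \<sigma> ^^ k) c, (inv_into UNIV \<sigma> ^^ Suc k) c)) [0..<?L])) ! k =
       map (\<lambda>k. F $$ ((\<sigma> ^^ k) c, (\<sigma> ^^ Suc k) c)) [0..<?L] ! k"
      using k by simp
  qed simp
  then show ?thesis
    unfolding cyc_prod_def cyc_len_inv[OF \<sigma>] qcnj_prod_list by simp
qed

text \<open>Passing to inverse permutations keeps leaders and signs. Conjugation reverses the whole
  product, which brings the distinguished cycle to the front and the others into increasing
  order.\<close>

lemma rdet_eq_cdet_ctr: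
  assumes F: "F \<in> carrier_mat n n" and i: "i < n"
  shows "rdet i F = qcnj (cdet i (ctr F))"
proof -
  have dims: "dim_row F = n" "dim_row (ctr F) = n" using F by (auto simp: ctr_def)
  have "qcnj (cdet i (ctr F)) = (\<Sum>\<sigma> | \<sigma> permutes {0..<n}. qcnj ((- 1) ^ (n - card (cyc_leaders n (inv_into UNIV \<sigma>))) *
       (prod_list (map (cyc_prod (ctr F) (inv_into UNIV \<sigma>)) (rev (sorted_list_of_set (other_leaders n (inv_into UNIV \<sigma>) i)))) *
        cyc_prod (ctr F) (inv_into UNIV \<sigma>) i)))"
    unfolding cdet_def Let_def dims qcnj_sum
    by (rule sum.reindex_bij_witness[where i = "inv_into UNIV" and j = "inv_into UNIV"])
      (auto simp: permutes_inv permutes_inv_inv)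
  also have "\<dots> = rdet i F"
    unfolding rdet_def Let_def dims
  proof (rule sum.cong[OF refl], clarify)
    fix \<sigma> assume \<sigma>: "\<sigma> permutes {0..<n}"
    let ?xs = "sorted_list_of_set (other_leaders n \<sigma> i)"
    have "finite (other_leaders n \<sigma> i)"
      by (rule finite_subset[of _ "{0..<n}"]) (auto simp: other_leaders_def cyc_leaders_def)
    then have 1: "map (\<lambda>x. qcnj (cyc_prod (ctr F) (inv_into UNIV \<sigma>) x)) ?xs = map (cyc_prod F \<sigma>) ?xs"
      by (intro map_cong refl cyc_prod_inv_ctr[OF \<sigma> F]) (auto simp: other_leaders_def cyc_leaders_def)
    have 2: "x * (- 1) ^ k = (- 1) ^ k * x" for x :: quat and k
      by (cases "even k") auto
    show "qcnj ((- 1) ^ (n - card (cyc_leaders n (inv_into UNIV \<sigma>))) *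
       (prod_list (map (cyc_prod (ctr F) (inv_into UNIV \<sigma>)) (rev (sorted_list_of_set (other_leaders n (inv_into UNIV \<sigma>) i)))) *
        cyc_prod (ctr F) (inv_into UNIV \<sigma>) i)) =
      (- 1) ^ (n - card (cyc_leaders n \<sigma>)) * (cyc_prod F \<sigma> i * prod_list (map (cyc_prod F \<sigma>) ?xs))"
      unfolding cyc_leaders_inv[OF \<sigma>] other_leaders_inv[OF \<sigma>]
      using cyc_prod_inv_ctr[OF \<sigma> F i]
      by (simp add: qcnj_prod_list rev_map o_def 1 2)
  qed
  finally show ?thesis ..
qed

lemma ctr_psub:
  assumes "G \<in> carrier_mat n n" "\<beta> \<in> Lk k n"
  shows "ctr (psub G \<beta>) = psub (ctr G) \<beta>"
proof -
  have "sorted_list_of_set \<beta> ! x < n" if "x < card \<beta>" for x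
    using bij_betw_nth_sorted[OF LkD(1)[OF assms(2)]] that LkD(2)[OF assms(2)]
    by (metis atLeastLessThan_iff bij_betwE zero_le)
  then show ?thesis
    using assms(1) by (intro eq_matI) (auto simp: ctr_def psub_def)
qed

lemma psub_carrier: "psub G \<beta> \<in> carrier_mat (card \<beta>) (card \<beta>)"
  by (simp add: psub_def)

lemma rdet_sub_eq_cdet_sub:
  assumes G: "G \<in> carrier_mat n n" and \<alpha>: "\<alpha> \<in> Lk k n" "j \<in> \<alpha>" and c: "dim_vec c = n"
  shows "rdet_sub G j c \<alpha> = qcnj (cdet_sub (ctr G) j (map_vec qcnj c) \<alpha>)"
proof -
  have R: "row_repl G j c \<in> carrier_mat n n" using G by (simp add: row_repl_def)
  have "ctr (row_repl G j c) = col_repl (ctr G) j (map_vec qcnj c)"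
    using G c by (intro eq_matI) (auto simp: ctr_def row_repl_def col_repl_def)
  then show ?thesis
    unfolding rdet_sub_def cdet_sub_def
    using rdet_eq_cdet_ctr[OF psub_carrier nth_sorted_pos_in(1)[OF LkD(1)[OF \<alpha>(1)] \<alpha>(2)]] ctr_psub[OF R \<alpha>(1)]
    by simp
qed

lemma pos_in_Min: "finite \<beta> \<Longrightarrow> pos_in \<beta> (Min \<beta>) = 0"
  by (auto simp: pos_in_def dest: Min_le)

text \<open>\<open>hdet\<close> is taken at position 0, which belongs to the least index of
  \<open>\<beta>\<close>, exactly where \<open>det_on\<close> is a column determinant. The
  conjugation between rows and columns disappears because the value is real; the empty set gives 1
  on both sides.\<close>

lemma hdet_psub:
  assumes G: "G \<in> carrier_mat n n" "ctr G = G" "\<beta> \<in> Lk k n"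
    and F: "hermitian F" "\<And>a c. a < n \<Longrightarrow> c < n \<Longrightarrow> G $$ (a, c) = F a c"
  shows "hdet (psub G \<beta>) = det_on \<beta> F"
proof (cases "\<beta> = {}")
  case True
  then show ?thesis by (simp add: hdet_def psub_def)
next
  case False
  note fin = LkD(1)[OF G(3)]
  then have m: "Min \<beta> \<in> \<beta>" "0 < card \<beta>" using False by (auto simp: card_gt_0_iff)
  have "hdet (psub G \<beta>) = rdet 0 (psub G \<beta>)" using m by (simp add: hdet_def psub_def)
  also have "\<dots> = qcnj (cdet 0 (psub G \<beta>))"
    using rdet_eq_cdet_ctr[OF psub_carrier m(2), of G] ctr_psub[OF G(1,3)] G(2) by simp
  also have "cdet 0 (psub G \<beta>) = det_on \<beta> F"
    using cdet_psub[OF fin m(1), of G F] F(2) LkD(2)[OF G(3)] fin False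
    by (simp add: det_on_eq_cdet_on pos_in_Min)
  finally show ?thesis using det_on_real[OF fin F(1)] by simp
qed

section \<open>The Moore--Penrose inverse\<close>

lemma ctr_carrier [simp]: "A \<in> carrier_mat m n \<Longrightarrow> ctr A \<in> carrier_mat n m"
  by (auto simp: ctr_def)

lemma dim_ctr [simp]: "dim_row (ctr A) = dim_col A" "dim_col (ctr A) = dim_row A"
  by (auto simp: ctr_def)

lemma ctr_index [simp]: "i < dim_col A \<Longrightarrow> j < dim_row A \<Longrightarrow> ctr A $$ (i, j) = qcnj (A $$ (j, i))"
  by (simp add: ctr_def)

lemma ctr_ctr [simp]: "ctr (ctr A) = A"
  by (intro eq_matI) auto

lemma ctr_mult:
  assumes "A \<in> carrier_mat m n" "B \<in> carrier_mat n k"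
  shows "ctr (A * B) = ctr B * ctr A"
  using assms by (intro eq_matI) (auto simp: scalar_prod_def)

lemma ctr_smult: "qcnj c = c \<Longrightarrow> ctr (c \<cdot>\<^sub>m A) = c \<cdot>\<^sub>m ctr A"
  by (intro eq_matI) (auto simp: real_quat_commute[of c])

lemma index_mult_mat_sum:
  assumes "A \<in> carrier_mat m n" "B \<in> carrier_mat n k" "i < m" "j < k"
  shows "(A * B) $$ (i, j) = (\<Sum>t<n. A $$ (i, t) * B $$ (t, j))"
  using assms by (simp add: scalar_prod_def lessThan_atLeast0)

text \<open>Scalars multiply entries from the left, so taking \<open>c\<close> out of the right
  factor relies on \<open>c\<close> being real.\<close>

lemma mult_smult_real:
  assumes "qcnj c = c" "A \<in> carrier_mat m n" "B \<in> carrier_mat n k"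
  shows "A * (c \<cdot>\<^sub>m B) = c \<cdot>\<^sub>m (A * B)"
proof -
  have "x * (c * y) = c * (x * y)" for x y
    by (metis real_quat_commute[OF assms(1)] mult.assoc)
  then show ?thesis
    using assms(2,3) by (intro eq_matI) (auto simp: scalar_prod_def sum_distrib_left)
qed

lemma smult_mult_left:
  assumes "A \<in> carrier_mat m n" "B \<in> carrier_mat n k"
  shows "(c \<cdot>\<^sub>m A) * B = c \<cdot>\<^sub>m (A * (B :: quat mat))"
  using assms by (intro eq_matI) (auto simp: scalar_prod_def sum_distrib_left mult.assoc)

lemma smult_smult_mat: "c \<cdot>\<^sub>m (e \<cdot>\<^sub>m A) = (c * e) \<cdot>\<^sub>m (A :: quat mat)"
  by (intro eq_matI) (auto simp: mult.assoc)

lemma mat_minus_zero: "A \<in> carrier_mat m n \<Longrightarrow> A - 0\<^sub>m m n = (A :: quat mat)"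
  by (intro eq_matI) auto

lemma one_smult_mat: "(1 :: quat) \<cdot>\<^sub>m A = A"
  by (intro eq_matI) auto

definition is_mpinv :: "quat mat \<Rightarrow> quat mat \<Rightarrow> bool" where
  "is_mpinv A X \<longleftrightarrow> X \<in> carrier_mat (dim_col A) (dim_row A) \<and>
     A * X * A = A \<and> X * A * X = X \<and> ctr (A * X) = A * X \<and> ctr (X * A) = X * A"

text \<open>\<open>A * X\<close> and \<open>A * Y\<close> are self-adjoint projections with the same
  range, hence equal; likewise \<open>X * A\<close> and \<open>Y * A\<close>. Then
  \<open>X = X * A * X\<close> can be rewritten into \<open>Y * A * Y\<close>.\<close>

lemma is_mpinv_unique:
  assumes "is_mpinv A X" "is_mpinv A Y"
  shows "X = Y"
proof -
  obtain m n where A: "A \<in> carrier_mat m n" by blast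
  then have X: "X \<in> carrier_mat n m" and Y: "Y \<in> carrier_mat n m"
    using assms by (auto simp: is_mpinv_def)
  note p = assms[unfolded is_mpinv_def]
  note c = A X Y mult_carrier_mat[OF A X] mult_carrier_mat[OF A Y] mult_carrier_mat[OF X A] mult_carrier_mat[OF Y A]
  have AX: "A * X = A * Y"
  proof -
    have "A * X = (A * Y * A) * X" using p by simp
    also have "\<dots> = (A * Y) * (A * X)" by (rule assoc_mult_mat[OF c(5) A X])
    also have "\<dots> = ctr (A * Y) * ctr (A * X)" using p by simp
    also have "\<dots> = ctr ((A * X) * (A * Y))" by (rule ctr_mult[OF c(4,5), symmetric])
    also have "(A * X) * (A * Y) = (A * X * A) * Y" by (rule assoc_mult_mat[OF c(4) A Y, symmetric])
    also have "\<dots> = A * Y" using p by simp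
    finally show ?thesis using p by simp
  qed
  have XA: "X * A = Y * A"
  proof -
    have "X * A = X * (A * Y * A)" using p by simp
    also have "\<dots> = (X * A) * (Y * A)"
      unfolding assoc_mult_mat[OF A Y A] by (rule assoc_mult_mat[OF X A c(7), symmetric])
    also have "\<dots> = ctr (X * A) * ctr (Y * A)" using p by simp
    also have "\<dots> = ctr ((Y * A) * (X * A))" by (rule ctr_mult[OF c(7,6), symmetric])
    also have "(Y * A) * (X * A) = Y * (A * X * A)"
      unfolding assoc_mult_mat[OF A X A] by (rule assoc_mult_mat[OF Y A c(6)])
    also have "\<dots> = Y * A" using p by simp
    finally show ?thesis using p by simp
  qed
  have "X = X * A * X" using p by simp
  also have "\<dots> = Y * (A * X)" unfolding XA by (rule assoc_mult_mat[OF Y A X])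
  also have "\<dots> = Y * A * Y" unfolding AX by (rule assoc_mult_mat[OF Y A Y, symmetric])
  also have "\<dots> = Y" using p by simp
  finally show ?thesis .
qed

lemma mpinv_eqI: "is_mpinv A X \<Longrightarrow> mpinv A = X"
  unfolding mpinv_def
  by (rule the_equality) (auto simp: is_mpinv_def intro: is_mpinv_unique[unfolded is_mpinv_def])

lemma is_mpinv_ctr:
  assumes "is_mpinv A X"
  shows "is_mpinv (ctr A) (ctr X)"
proof -
  obtain m n where A: "A \<in> carrier_mat m n" by blast
  then have X: "X \<in> carrier_mat n m" using assms by (auto simp: is_mpinv_def)
  note p = assms[unfolded is_mpinv_def]
  have 1: "ctr A * ctr X = ctr (X * A)" "ctr X * ctr A = ctr (A * X)"
    using ctr_mult[OF X A] ctr_mult[OF A X] by auto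
  have "ctr A * ctr X * ctr A = ctr (A * (X * A))" "ctr X * ctr A * ctr X = ctr (X * (A * X))"
    unfolding 1 using ctr_mult[OF A mult_carrier_mat[OF X A]] ctr_mult[OF X mult_carrier_mat[OF A X]] by auto
  then show ?thesis
    unfolding is_mpinv_def 1 using p A X by (auto simp: assoc_mult_mat[OF A X A] assoc_mult_mat[OF X A X])
qed

section \<open>The Moore-Penrose inverse from cofactor sums\<close>

definition cof_mat :: "quat mat \<Rightarrow> quat mat" where
  "cof_mat A = mat (dim_col A) (dim_col A) (\<lambda>(i, l). cofs (dim_col A) (qrank A) (gram A) i l)"

definition det_sum :: "quat mat \<Rightarrow> quat" where
  "det_sum A = dets (dim_col A) (qrank A) (gram A)"

lemma det_sum_real: "qcnj (det_sum A) = det_sum A"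
  by (simp add: det_sum_def dets_real hermitian_gram)

lemma det_sum_nonzero: "det_sum A \<noteq> 0"
  using dets_gram_pos[of A] by (auto simp: det_sum_def)

lemma cof_mat_carrier: "A \<in> carrier_mat m n \<Longrightarrow> cof_mat A \<in> carrier_mat n n"
  by (auto simp: cof_mat_def)

lemma ctr_cof_mat: "ctr (cof_mat A) = cof_mat A"
  by (intro eq_matI) (auto simp: cof_mat_def cofs_sym hermitian_gram)

lemma gram_eq: "a < dim_col A \<Longrightarrow> c < dim_col A \<Longrightarrow> (ctr A * A) $$ (a, c) = gram A a c"
  by (simp add: scalar_prod_def gram_def lessThan_atLeast0)

text \<open>The coefficient following \<open>cof_mat\<close>. Once the Moore-Penrose inverse is
  known, it is seen to be \<open>det_sum A\<close> times the projection \<open>LL A\<close>.\<close>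

definition residual :: "quat mat \<Rightarrow> quat mat" where
  "residual A = mat (dim_col A) (dim_col A) (\<lambda>(i, l). cofs (dim_col A) (Suc (qrank A)) (gram A) i l)"

lemma residual_carrier: "A \<in> carrier_mat m n \<Longrightarrow> residual A \<in> carrier_mat n n"
  by (auto simp: residual_def)

lemma residual_mult_ctr:
  assumes "A \<in> carrier_mat m n"
  shows "residual A * ctr A = 0\<^sub>m n m"
  using assms cofs_gram_annihilates[of _ A]
  by (intro eq_matI) (auto simp: residual_def scalar_prod_def lessThan_atLeast0)

lemma cof_mat_mult_gram:
  assumes "A \<in> carrier_mat m n"
  shows "cof_mat A * (ctr A * A) = det_sum A \<cdot>\<^sub>m 1\<^sub>m n - residual A"
proof (rule eq_matI)
  fix i l assume "i < dim_row (det_sum A \<cdot>\<^sub>m 1\<^sub>m n - residual A)" "l < dim_col (det_sum A \<cdot>\<^sub>m 1\<^sub>m n - residual A)"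
  then have il: "i < n" "l < n" using residual_carrier[OF assms] by auto
  have n: "dim_col A = n" using assms by auto
  have G: "ctr A * A \<in> carrier_mat n n" using assms by auto
  have "(cof_mat A * (ctr A * A)) $$ (i, l) = (\<Sum>j<n. cof_mat A $$ (i, j) * (ctr A * A) $$ (j, l))"
    by (rule index_mult_mat_sum[OF cof_mat_carrier[OF assms] G il])
  also have "\<dots> = (\<Sum>j<n. cofs n (qrank A) (gram A) i j * gram A j l)"
    using il n gram_eq[of _ A] by (intro sum.cong refl) (simp add: cof_mat_def)
  also have "\<dots> = (if i = l then det_sum A else 0) - cofs n (Suc (qrank A)) (gram A) i l"
    using cofs_recursion[OF hermitian_gram[of A] il, of "qrank A"]
    by (simp add: det_sum_def n algebra_simps)
  also have "\<dots> = (det_sum A \<cdot>\<^sub>m 1\<^sub>m n - residual A) $$ (i, l)"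
    using il n by (simp add: residual_def)
  finally show "(cof_mat A * (ctr A * A)) $$ (i, l) = (det_sum A \<cdot>\<^sub>m 1\<^sub>m n - residual A) $$ (i, l)" .
qed (use assms cof_mat_carrier[OF assms] residual_carrier[OF assms] in auto)

text \<open>Both factors are self-adjoint, and by \<open>cof_mat_mult_gram\<close> so is their
  product.\<close>

lemma cof_mat_gram_commute:
  assumes "A \<in> carrier_mat m n"
  shows "(ctr A * A) * cof_mat A = cof_mat A * (ctr A * A)"
proof -
  have G: "ctr A * A \<in> carrier_mat n n" "ctr (ctr A * A) = ctr A * A"
    using assms ctr_mult[OF ctr_carrier[OF assms] assms] by auto
  have "(ctr A * A) * cof_mat A = ctr (cof_mat A * (ctr A * A))"
    using ctr_mult[OF cof_mat_carrier[OF assms] G(1)] G(2) ctr_cof_mat by simp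
  also have "\<dots> = cof_mat A * (ctr A * A)"
    unfolding cof_mat_mult_gram[OF assms]
    using assms by (intro eq_matI) (auto simp: residual_def cofs_sym hermitian_gram det_sum_real)
  finally show ?thesis .
qed

lemma cof_mat_gram_ctr:
  assumes "A \<in> carrier_mat m n"
  shows "cof_mat A * (ctr A * A) * ctr A = det_sum A \<cdot>\<^sub>m ctr A"
proof -
  note c = ctr_carrier[OF assms] residual_carrier[OF assms]
  have "cof_mat A * (ctr A * A) * ctr A = (det_sum A \<cdot>\<^sub>m 1\<^sub>m n) * ctr A - residual A * ctr A"
    unfolding cof_mat_mult_gram[OF assms] using c by (intro minus_mult_distrib_mat) auto
  also have "(det_sum A \<cdot>\<^sub>m 1\<^sub>m n) * ctr A = det_sum A \<cdot>\<^sub>m ctr A"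
    using c by (subst smult_mult_left[of _ n n _ m]) auto
  finally show ?thesis
    using c unfolding residual_mult_ctr[OF assms] by (simp add: mat_minus_zero)
qed

text \<open>All four Penrose conditions come from three facts: \<open>cof_mat A\<close> is
  self-adjoint, it commutes with \<open>ctr A * A\<close>, and the product of these two acts on
  \<open>ctr A\<close> as the real scalar \<open>det_sum A\<close>.\<close>

lemma is_mpinv_cof_mat: "is_mpinv A (inverse (det_sum A) \<cdot>\<^sub>m (cof_mat A * ctr A))"
proof -
  obtain m n where A: "A \<in> carrier_mat m n" by blast
  let ?a = "ctr A" and ?P = "cof_mat A" and ?d = "det_sum A"
  let ?G = "?a * A" and ?e = "inverse ?d"
  note a = ctr_carrier[OF A] and P = cof_mat_carrier[OF A]
  note G = mult_carrier_mat[OF a A] and Pa = mult_carrier_mat[OF P a]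
  note PG = mult_carrier_mat[OF P G]
  have e: "qcnj ?e = ?e" by (rule real_quat_inverse[OF det_sum_real])
  have ed: "?e * ?d = 1" by (rule quat_inverse(1)[OF det_sum_nonzero])
  let ?X = "?e \<cdot>\<^sub>m (?P * ?a)"
  have X: "?X \<in> carrier_mat n m" using Pa by simp
  have PaA: "?P * ?a * A = ?P * ?G" by (rule assoc_mult_mat[OF P a A])
  have AX: "A * ?X = ?e \<cdot>\<^sub>m (A * (?P * ?a))" by (rule mult_smult_real[OF e A Pa])
  have XA: "?X * A = ?e \<cdot>\<^sub>m (?P * ?G)"
    using smult_mult_left[OF Pa A] PaA by simp
  have ctr_G: "ctr ?G = ?G" using ctr_mult[OF a A] by simp
  have "ctr (A * (?P * ?a)) = A * ?P * ?a"
    using ctr_mult[OF A Pa] ctr_mult[OF P a] ctr_cof_mat[of A] by simp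
  also have "\<dots> = A * (?P * ?a)" by (rule assoc_mult_mat[OF A P a])
  finally have c1: "ctr (A * ?X) = A * ?X" unfolding AX ctr_smult[OF e] by simp
  have ctr_PG: "ctr (?P * ?G) = ?P * ?G"
    using ctr_mult[OF P G] ctr_G ctr_cof_mat[of A] cof_mat_gram_commute[OF A] by simp
  then have c2: "ctr (?X * A) = ?X * A" unfolding XA ctr_smult[OF e] by simp
  \<comment> \<open>The adjoint of \<open>cof_mat_gram_ctr\<close>, needed because the first Penrose
    condition has \<open>A\<close> on the left.\<close>
  have "ctr (A * (?P * ?G)) = ?d \<cdot>\<^sub>m ?a"
    using ctr_mult[OF A PG] ctr_PG cof_mat_gram_ctr[OF A] by simp
  then have "ctr (ctr (A * (?P * ?G))) = ctr (?d \<cdot>\<^sub>m ?a)" by simp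
  then have APG: "A * (?P * ?G) = ?d \<cdot>\<^sub>m A" by (simp add: ctr_smult det_sum_real)
  have "A * ?X * A = A * (?X * A)" by (rule assoc_mult_mat[OF A X A])
  also have "\<dots> = ?e \<cdot>\<^sub>m (A * (?P * ?G))" unfolding XA by (rule mult_smult_real[OF e A PG])
  finally have m1: "A * ?X * A = A" by (simp add: APG smult_smult_mat ed one_smult_mat)
  have "?P * ?G * (?P * ?a) = ?P * (?G * (?P * ?a))" by (rule assoc_mult_mat[OF P G Pa])
  also have "?G * (?P * ?a) = ?d \<cdot>\<^sub>m ?a"
    using assoc_mult_mat[OF G P a] cof_mat_gram_commute[OF A] cof_mat_gram_ctr[OF A] by simp
  also have "?P * (?d \<cdot>\<^sub>m ?a) = ?d \<cdot>\<^sub>m (?P * ?a)" by (rule mult_smult_real[OF det_sum_real P a])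
  finally have PGPa: "?P * ?G * (?P * ?a) = ?d \<cdot>\<^sub>m (?P * ?a)" .
  have "?X * A * ?X = ?e \<cdot>\<^sub>m (?P * ?G * ?X)"
    unfolding XA by (rule smult_mult_left[OF PG X])
  also have "?P * ?G * ?X = ?e \<cdot>\<^sub>m (?d \<cdot>\<^sub>m (?P * ?a))"
    using mult_smult_real[OF e PG Pa] PGPa by simp
  finally have m2: "?X * A * ?X = ?X" by (simp add: smult_smult_mat ed one_smult_mat)
  show ?thesis unfolding is_mpinv_def using X A c1 c2 m1 m2 by auto
qed

lemma mpinv_eq: "mpinv A = inverse (det_sum A) \<cdot>\<^sub>m (cof_mat A * ctr A)"
  by (rule mpinv_eqI[OF is_mpinv_cof_mat])

lemma is_mpinv_mpinv: "is_mpinv A (mpinv A)"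
  unfolding mpinv_eq by (rule is_mpinv_cof_mat)

lemma mpinv_carrier: "A \<in> carrier_mat m n \<Longrightarrow> mpinv A \<in> carrier_mat n m"
  using is_mpinv_mpinv[of A] by (auto simp: is_mpinv_def)

lemma mpinv_ctr: "mpinv (ctr A) = ctr (mpinv A)"
  by (rule mpinv_eqI[OF is_mpinv_ctr[OF is_mpinv_mpinv]])

lemma cof_mat_mult_ctr: "cof_mat A * ctr A = det_sum A \<cdot>\<^sub>m mpinv A"
  by (simp add: mpinv_eq smult_smult_mat quat_inverse(2)[OF det_sum_nonzero] one_smult_mat)

section \<open>Trace and rank\<close>

definition mtrace :: "quat mat \<Rightarrow> quat" where
  "mtrace A = (\<Sum>i<dim_row A. A $$ (i, i))"

lemma qre_mtrace_commute:
  assumes "A \<in> carrier_mat m n" "B \<in> carrier_mat n m"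
  shows "qre (mtrace (A * B)) = qre (mtrace (B * A))"
proof -
  have "qre (mtrace (A * B)) = (\<Sum>i<m. \<Sum>t<n. qre (A $$ (i, t) * B $$ (t, i)))"
    using assms by (simp add: mtrace_def index_mult_mat_sum[OF assms] qre_sum del: index_mult_mat(1) quat_sel)
  also have "\<dots> = (\<Sum>i<m. \<Sum>t<n. qre (B $$ (t, i) * A $$ (i, t)))"
    by (intro sum.cong refl qre_mult_commute)
  also have "\<dots> = (\<Sum>t<n. \<Sum>i<m. qre (B $$ (t, i) * A $$ (i, t)))"
    by (rule sum.swap)
  also have "\<dots> = qre (mtrace (B * A))"
    using assms by (simp add: mtrace_def index_mult_mat_sum[OF assms(2,1)] qre_sum del: index_mult_mat(1) quat_sel)
  finally show ?thesis .
qed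

lemma qrank_le: "qrank A \<le> dim_col A"
  using card_mono[of "{0..<dim_col A}"] by (metis card_atLeastLessThan finite_atLeastLessThan minus_nat.diff_0 qrank_indep)

lemma qre_of_nat [simp]: "qre (of_nat k) = real k"
  by (induction k) auto

lemma mtrace_mpinv: "mtrace (mpinv A * A) = of_nat (qrank A)"
proof -
  obtain m n where A: "A \<in> carrier_mat m n" by blast
  then have n: "dim_col A = n" by auto
  let ?r = "qrank A" and ?d = "det_sum A"
  have "mpinv A * A = inverse ?d \<cdot>\<^sub>m (cof_mat A * ctr A * A)"
    unfolding mpinv_eq by (rule smult_mult_left[OF mult_carrier_mat[OF cof_mat_carrier[OF A] ctr_carrier[OF A]] A])
  also have "cof_mat A * ctr A * A = ?d \<cdot>\<^sub>m 1\<^sub>m n - residual A"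
    unfolding cof_mat_mult_gram[OF A, symmetric] by (rule assoc_mult_mat[OF cof_mat_carrier[OF A] ctr_carrier[OF A] A])
  finally have "mtrace (mpinv A * A) = inverse ?d * (\<Sum>i<n. ?d - cofs n (Suc ?r) (gram A) i i)"
    using residual_carrier[OF A] by (simp add: mtrace_def sum_distrib_left residual_def n)
  also have "(\<Sum>i<n. ?d - cofs n (Suc ?r) (gram A) i i) = of_nat n * ?d - of_nat (n - ?r) * ?d"
    using cofs_trace[OF hermitian_gram[of A], of n ?r] by (simp add: sum_subtractf det_sum_def n)
  \<comment> \<open>\<open>qrank_le\<close> ensures that the truncated difference
    \<open>n - ?r\<close> is the true one.\<close>
  also have "\<dots> = ?d * of_nat ?r"
    using qrank_le[of A] n by (simp add: of_nat_diff algebra_simps mult_of_nat_commute)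
  finally show ?thesis
    by (simp add: mult.assoc[symmetric] quat_inverse(1)[OF det_sum_nonzero])
qed

text \<open>\<open>qrank\<close> counts right independent columns, which is not visibly symmetric.
  The real part of a trace is unchanged by \<open>ctr\<close> and by exchanging two factors, so both
  ranks are read off the same number.\<close>

lemma qrank_ctr: "qrank (ctr A) = qrank A"
proof -
  obtain m n where A: "A \<in> carrier_mat m n" by blast
  note X = mpinv_carrier[OF A]
  have "mpinv (ctr A) * ctr A = ctr (A * mpinv A)"
    unfolding mpinv_ctr ctr_mult[OF A X] ..
  then have "real (qrank (ctr A)) = qre (mtrace (ctr (A * mpinv A)))"
    using mtrace_mpinv[of "ctr A"] by simp
  also have "\<dots> = qre (mtrace (A * mpinv A))"
    using A X by (simp add: mtrace_def qre_sum del: index_mult_mat(1))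
  also have "\<dots> = real (qrank A)"
    using qre_mtrace_commute[OF A X] mtrace_mpinv[of A] by simp
  finally show ?thesis by simp
qed

lemma ctr_mult_cof_mat:
  assumes "B \<in> carrier_mat r s"
  shows "ctr B * cof_mat (ctr B) = det_sum (ctr B) \<cdot>\<^sub>m mpinv B"
proof -
  have "ctr (cof_mat (ctr B) * B) = ctr (det_sum (ctr B) \<cdot>\<^sub>m ctr (mpinv B))"
    using cof_mat_mult_ctr[of "ctr B"] by (simp add: mpinv_ctr)
  then show ?thesis
    using ctr_mult[OF cof_mat_carrier[OF ctr_carrier[OF assms]] assms]
    by (simp add: ctr_smult[OF det_sum_real] ctr_cof_mat)
qed

section \<open>Determinantal representations\<close>

lemma Lki_iff: "\<beta> \<in> Lki k n i \<longleftrightarrow> \<beta> \<in> Lk k n \<and> i \<in> \<beta>"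
  by (simp add: Lki_def)

text \<open>Each numerator is linear in the replaced column with cofactors as coefficients; extended
  by zero and summed over \<open>\<beta>\<close>, these form row \<open>i\<close> of
  \<open>cof_mat A\<close>.\<close>

lemma sum_cdet_sub:
  assumes A: "A \<in> carrier_mat m n" and i: "i < n" and b: "dim_vec b = n"
  shows "(\<Sum>\<beta>\<in>Lki (qrank A) n i. cdet_sub (ctr A * A) i b \<beta>) = (\<Sum>k<n. cof_mat A $$ (i, k) * b $ k)"
proof -
  let ?F = "gram A" and ?L = "Lk (qrank A) n"
  have n: "dim_col A = n" using A by auto
  have G: "ctr A * A \<in> carrier_mat n n" using A by auto
  have "(\<Sum>\<beta>\<in>Lki (qrank A) n i. cdet_sub (ctr A * A) i b \<beta>) =
      (\<Sum>\<beta>\<in>?L. \<Sum>k<n. (if i \<in> \<beta> \<and> k \<in> \<beta> then cof \<beta> ?F i k else 0) * b $ k)"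
  proof (rule sum.mono_neutral_cong_left)
    fix \<beta> assume "\<beta> \<in> Lki (qrank A) n i"
    then have \<beta>: "\<beta> \<in> ?L" "i \<in> \<beta>" by (auto simp: Lki_iff)
    have "cdet_sub (ctr A * A) i b \<beta> = cramer \<beta> ?F i (\<lambda>a. b $ a)"
      by (rule cdet_sub_eq_cramer[OF G _ \<beta>]) (use gram_eq n in auto)
    also have "\<dots> = (\<Sum>k\<in>\<beta>. cof \<beta> ?F i k * b $ k)"
      by (rule cramer_eq_sum[OF LkD(1)[OF \<beta>(1)] hermitian_gram \<beta>(2)])
    also have "\<dots> = (\<Sum>k<n. (if i \<in> \<beta> \<and> k \<in> \<beta> then cof \<beta> ?F i k else 0) * b $ k)"
      by (rule sum.mono_neutral_cong_left) (use LkD[OF \<beta>(1)] \<beta>(2) in auto)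
    finally show "cdet_sub (ctr A * A) i b \<beta> = (\<Sum>k<n. (if i \<in> \<beta> \<and> k \<in> \<beta> then cof \<beta> ?F i k else 0) * b $ k)" .
  qed (auto simp: Lki_iff)
  also have "\<dots> = (\<Sum>k<n. \<Sum>\<beta>\<in>?L. (if i \<in> \<beta> \<and> k \<in> \<beta> then cof \<beta> ?F i k else 0) * b $ k)"
    by (rule sum.swap)
  also have "\<dots> = (\<Sum>k<n. cof_mat A $$ (i, k) * b $ k)"
    using i by (intro sum.cong refl) (simp add: cof_mat_def cofs_def n sum_distrib_right)
  finally show ?thesis .
qed

text \<open>The column formula for \<open>ctr B\<close>, conjugated. \<open>qrank_ctr\<close> is
  what makes the sizes of the minors match, as \<open>cof_mat (ctr B)\<close> is built with the rank
  of \<open>ctr B\<close>.\<close>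

lemma sum_rdet_sub:
  assumes B: "B \<in> carrier_mat r s" and j: "j < r" and c: "dim_vec c = r"
  shows "(\<Sum>\<alpha>\<in>Lki (qrank B) r j. rdet_sub (B * ctr B) j c \<alpha>) = (\<Sum>l<r. c $ l * cof_mat (ctr B) $$ (l, j))"
proof -
  have A: "ctr B \<in> carrier_mat s r" using B by simp
  have G: "B * ctr B \<in> carrier_mat r r" using B by auto
  have ctrG: "ctr (B * ctr B) = B * ctr B" using ctr_mult[OF B A] by simp
  have "(\<Sum>\<alpha>\<in>Lki (qrank B) r j. rdet_sub (B * ctr B) j c \<alpha>) =
      qcnj (\<Sum>\<alpha>\<in>Lki (qrank B) r j. cdet_sub (B * ctr B) j (map_vec qcnj c) \<alpha>)"
    unfolding qcnj_sum
    by (intro sum.cong refl) (use rdet_sub_eq_cdet_sub[OF G _ _ c] ctrG in \<open>auto simp: Lki_iff\<close>)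
  also have "(\<Sum>\<alpha>\<in>Lki (qrank B) r j. cdet_sub (B * ctr B) j (map_vec qcnj c) \<alpha>) =
      (\<Sum>l<r. cof_mat (ctr B) $$ (j, l) * map_vec qcnj c $ l)"
    using sum_cdet_sub[OF A j, of "map_vec qcnj c"] c by (simp add: qrank_ctr)
  also have "qcnj \<dots> = (\<Sum>l<r. c $ l * qcnj (cof_mat (ctr B) $$ (j, l)))"
    using c by simp
  also have "\<dots> = (\<Sum>l<r. c $ l * cof_mat (ctr B) $$ (l, j))"
    using j B by (intro sum.cong refl) (simp add: cof_mat_def cofs_sym hermitian_gram)
  finally show ?thesis .
qed

lemma minsum_col:
  assumes A: "A \<in> carrier_mat m n"
  shows "minsum (qrank A) (ctr A * A) = det_sum A"
proof -
  have n: "dim_col A = n" using A by auto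
  have G: "ctr A * A \<in> carrier_mat n n" "ctr (ctr A * A) = ctr A * A"
    using A ctr_mult[OF ctr_carrier[OF A] A] by auto
  show ?thesis
    unfolding minsum_def det_sum_def dets_def
    using G(1) n by (intro sum.cong hdet_psub[OF G _ hermitian_gram]) (auto simp: gram_eq simp del: index_mult_mat(1))
qed

lemma minsum_row:
  assumes B: "B \<in> carrier_mat r s"
  shows "minsum (qrank B) (B * ctr B) = det_sum (ctr B)"
  using minsum_col[OF ctr_carrier[OF B]] by (simp add: qrank_ctr)

lemma assoc_mult_dim:
  "dim_col A = dim_row B \<Longrightarrow> dim_col B = dim_row C \<Longrightarrow> A * B * C = A * (B * (C :: quat mat))"
  by (rule assoc_mult_mat[of _ "dim_row A" "dim_col A" _ "dim_col B" _ "dim_col C"]) auto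

text \<open>The columns of \<open>ctr A * Y\<close> make the sum an entry of
  \<open>cof_mat A * ctr A * Y\<close>, and \<open>cof_mat A * ctr A\<close> is a real multiple of
  the Moore-Penrose inverse.\<close>

lemma sum_cdet_sub_col:
  assumes A: "A \<in> carrier_mat m n" and Y: "Y \<in> carrier_mat m p" and it: "i < n" "t < p"
  shows "(\<Sum>\<beta>\<in>Lki (qrank A) n i. cdet_sub (ctr A * A) i (col (ctr A * Y) t) \<beta>) = det_sum A * (mpinv A * Y) $$ (i, t)"
proof -
  note a = ctr_carrier[OF A] and P = cof_mat_carrier[OF A] and X = mpinv_carrier[OF A]
  note aY = mult_carrier_mat[OF a Y]
  have dim: "dim_vec (col (ctr A * Y) t) = n" using A by simp
  have "(\<Sum>\<beta>\<in>Lki (qrank A) n i. cdet_sub (ctr A * A) i (col (ctr A * Y) t) \<beta>) = (cof_mat A * (ctr A * Y)) $$ (i, t)"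
    unfolding sum_cdet_sub[OF A it(1) dim] index_mult_mat_sum[OF P aY it]
    by (intro sum.cong refl) (use A Y it in \<open>simp del: index_mult_mat(1)\<close>)
  also have "cof_mat A * (ctr A * Y) = det_sum A \<cdot>\<^sub>m (mpinv A * Y)"
    using assoc_mult_mat[OF P a Y] smult_mult_left[OF X Y] by (simp add: cof_mat_mult_ctr)
  finally show ?thesis using X Y it by simp
qed

lemma sum_rdet_sub_row:
  assumes B: "B \<in> carrier_mat r s" and Y: "Y \<in> carrier_mat q s" and fj: "f < q" "j < r"
  shows "(\<Sum>\<alpha>\<in>Lki (qrank B) r j. rdet_sub (B * ctr B) j (row (Y * ctr B) f) \<alpha>) = det_sum (ctr B) * (Y * mpinv B) $$ (f, j)"
proof -
  note b = ctr_carrier[OF B] and X = mpinv_carrier[OF B]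
  note R = cof_mat_carrier[OF b] and Yb = mult_carrier_mat[OF Y b]
  have dim: "dim_vec (row (Y * ctr B) f) = r" using B by simp
  have "(\<Sum>\<alpha>\<in>Lki (qrank B) r j. rdet_sub (B * ctr B) j (row (Y * ctr B) f) \<alpha>) = (Y * ctr B * cof_mat (ctr B)) $$ (f, j)"
    unfolding sum_rdet_sub[OF B fj(2) dim] index_mult_mat_sum[OF Yb R fj]
    by (intro sum.cong refl) (use B Y fj in \<open>simp del: index_mult_mat(1)\<close>)
  also have "Y * ctr B * cof_mat (ctr B) = det_sum (ctr B) \<cdot>\<^sub>m (Y * mpinv B)"
    using assoc_mult_mat[OF Y b R] mult_smult_real[OF det_sum_real Y X] by (simp add: ctr_mult_cof_mat[OF B])
  finally show ?thesis using X Y fj by simp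
qed

text \<open>Both nested sums are entries of
  \<open>cof_mat A * (ctr A * C * ctr B) * cof_mat (ctr B)\<close>, bracketed in two ways: the inner
  sum multiplies by one cofactor matrix, the outer sum by the other. Associativity is why the paired
  formulas agree.\<close>

lemma
  assumes A: "A \<in> carrier_mat m n" and B: "B \<in> carrier_mat r s" and C: "C \<in> carrier_mat m s"
    and ij: "i < n" "j < r"
  shows sum_cdet_sub_rdet_sub:
    "(\<Sum>\<beta>\<in>Lki (qrank A) n i. cdet_sub (ctr A * A) i
        (vec n (\<lambda>k. \<Sum>\<alpha>\<in>Lki (qrank B) r j. rdet_sub (B * ctr B) j (row (ctr A * C * ctr B) k) \<alpha>)) \<beta>) =
      det_sum A * det_sum (ctr B) * (mpinv A * C * mpinv B) $$ (i, j)" (is ?col)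
    and sum_rdet_sub_cdet_sub:
    "(\<Sum>\<alpha>\<in>Lki (qrank B) r j. rdet_sub (B * ctr B) j
        (vec r (\<lambda>l. \<Sum>\<beta>\<in>Lki (qrank A) n i. cdet_sub (ctr A * A) i (col (ctr A * C * ctr B) l) \<beta>)) \<alpha>) =
      det_sum A * det_sum (ctr B) * (mpinv A * C * mpinv B) $$ (i, j)" (is ?row)
proof -
  note a = ctr_carrier[OF A] and P = cof_mat_carrier[OF A] and X = mpinv_carrier[OF A]
  note b = ctr_carrier[OF B] and Y = mpinv_carrier[OF B]
  note R = cof_mat_carrier[OF b]
  let ?C = "ctr A * C * ctr B" and ?Z = "mpinv A * C * mpinv B"
  have C1: "?C \<in> carrier_mat n r" using a b C by auto
  have dims: "dim_row A = m" "dim_col A = n" "dim_row B = r" "dim_col B = s" "dim_row C = m" "dim_col C = s"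
    "dim_row (cof_mat A) = n" "dim_col (cof_mat A) = n" "dim_row (cof_mat (ctr B)) = r" "dim_col (cof_mat (ctr B)) = r"
    "dim_row (mpinv A) = n" "dim_col (mpinv A) = m" "dim_row (mpinv B) = s" "dim_col (mpinv B) = r"
    using A B C P R X Y by auto
  have dimr: "dim_vec (row ?C k) = r" and dimc: "dim_vec (col ?C k) = n" for k
    by (simp_all add: dims)
  have "cof_mat A * ?C * cof_mat (ctr B) = (cof_mat A * ctr A) * (C * (ctr B * cof_mat (ctr B)))"
    by (simp add: assoc_mult_dim dims)
  also have "\<dots> = det_sum A \<cdot>\<^sub>m (mpinv A * (det_sum (ctr B) \<cdot>\<^sub>m (C * mpinv B)))"
    unfolding cof_mat_mult_ctr ctr_mult_cof_mat[OF B] mult_smult_real[OF det_sum_real C Y]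
    by (rule smult_mult_left[OF X]) (use C Y in auto)
  also have "\<dots> = (det_sum A * det_sum (ctr B)) \<cdot>\<^sub>m (mpinv A * (C * mpinv B))"
    unfolding mult_smult_real[OF det_sum_real X mult_carrier_mat[OF C Y]] smult_smult_mat ..
  also have "mpinv A * (C * mpinv B) = ?Z" by (simp add: assoc_mult_dim dims)
  finally have key: "(cof_mat A * ?C * cof_mat (ctr B)) $$ (i, j) = det_sum A * det_sum (ctr B) * ?Z $$ (i, j)"
    using ij by (simp add: dims)
  have CR: "?C * cof_mat (ctr B) \<in> carrier_mat n r" and PC: "cof_mat A * ?C \<in> carrier_mat n r"
    using C1 R P by auto
  have "(\<Sum>\<alpha>\<in>Lki (qrank B) r j. rdet_sub (B * ctr B) j (row ?C k) \<alpha>) = (?C * cof_mat (ctr B)) $$ (k, j)" if "k < n" for k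
    unfolding sum_rdet_sub[OF B ij(2) dimr] index_mult_mat_sum[OF C1 R that ij(2)]
    by (intro sum.cong refl) (use that in \<open>simp add: dims del: index_mult_mat(1)\<close>)
  then have "(\<Sum>\<beta>\<in>Lki (qrank A) n i. cdet_sub (ctr A * A) i
        (vec n (\<lambda>k. \<Sum>\<alpha>\<in>Lki (qrank B) r j. rdet_sub (B * ctr B) j (row ?C k) \<alpha>)) \<beta>) =
      (cof_mat A * (?C * cof_mat (ctr B))) $$ (i, j)"
    unfolding index_mult_mat_sum[OF P CR ij] by (subst sum_cdet_sub[OF A ij(1)]) (simp_all del: index_mult_mat(1))
  also have "cof_mat A * (?C * cof_mat (ctr B)) = cof_mat A * ?C * cof_mat (ctr B)"
    by (rule assoc_mult_mat[OF P C1 R, symmetric])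
  finally show ?col unfolding key .
  have "(\<Sum>\<beta>\<in>Lki (qrank A) n i. cdet_sub (ctr A * A) i (col ?C l) \<beta>) = (cof_mat A * ?C) $$ (i, l)" if "l < r" for l
    unfolding sum_cdet_sub[OF A ij(1) dimc] index_mult_mat_sum[OF P C1 ij(1) that]
    by (intro sum.cong refl) (use that in \<open>simp add: dims del: index_mult_mat(1)\<close>)
  then have "(\<Sum>\<alpha>\<in>Lki (qrank B) r j. rdet_sub (B * ctr B) j
        (vec r (\<lambda>l. \<Sum>\<beta>\<in>Lki (qrank A) n i. cdet_sub (ctr A * A) i (col ?C l) \<beta>)) \<alpha>) =
      (cof_mat A * ?C * cof_mat (ctr B)) $$ (i, j)"
    unfolding index_mult_mat_sum[OF PC R ij] by (subst sum_rdet_sub[OF B ij(2)]) (simp_all del: index_mult_mat(1))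
  then show ?row unfolding key .
qed

section \<open>Real scalars and the assembly of the solution pair\<close>

lemma real_mult_divide:
  assumes "qcnj d = d" "d \<noteq> 0"
  shows "d * z / d = z"
  unfolding divide_quat_def
  using real_quat_commute[OF assms(1), of z] quat_inverse(2)[OF assms(2)] by (simp add: mult.assoc)

lemma real_quat_mult: "qcnj x = x \<Longrightarrow> qcnj y = y \<Longrightarrow> qcnj (x * y) = x * y"
  by (simp add: real_quat_commute[of y x])

text \<open>Gathers the scalars of two blocks in front to form a common denominator, while
  \<open>u\<close> and \<open>v\<close> keep their order.\<close>

lemma real_quat_rearrange:
  assumes "qcnj b = b" "qcnj c = c"
  shows "a * u * (b * c * v) = a * b * c * (u * v)"
proof -
  have "u * (b * c) = b * c * u"
    by (rule real_quat_commute[OF real_quat_mult[OF assms], symmetric])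
  then have "a * (u * (b * c)) * v = a * (b * c * u) * v" by (rule arg_cong)
  then show ?thesis by (simp only: mult.assoc)
qed

lemma real_quat_rearrange4:
  assumes "qcnj b = b" "qcnj c = c" "qcnj d = d"
  shows "a * u * (b * c * v) * (d * w) = a * b * c * d * (u * (v * w))"
proof -
  have "a * u * (b * c * v) * (d * w) = a * b * c * (u * v * d) * w"
    unfolding real_quat_rearrange[OF assms(1,2), of a u v] by (simp only: mult.assoc)
  also have "u * v * d = d * (u * v)" by (rule real_quat_commute[OF assms(3), symmetric])
  finally show ?thesis by (simp only: mult.assoc)
qed

theorem theorem3p3:
  fixes A1 B1 A2 B2 C :: "quat mat" and m n r s p q r1 r2 r3 r4 r5 r6 r7 :: nat
  assumes "A1 \<in> carrier_mat m n" "B1 \<in> carrier_mat r s" "A2 \<in> carrier_mat m p"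
    "B2 \<in> carrier_mat q s" "C \<in> carrier_mat m s"
    "qrank A1 = r1" "qrank B1 = r2" "qrank A2 = r3" "qrank B2 = r4"
  defines "M \<equiv> RR A1 * A2" and "N \<equiv> B2 * LL B1"
  defines "S \<equiv> A2 * LL M"
  assumes "qrank M = r5" "qrank N = r6" "qrank S = r7"
  defines "X1 \<equiv> mpinv A1 * C * mpinv B1 - mpinv A1 * A2 * mpinv M * C * mpinv B1
                 - mpinv A1 * S * mpinv A2 * C * mpinv N * B2 * mpinv B1"
    and "X2 \<equiv> mpinv M * C * mpinv B2 + PP S * mpinv A2 * C * mpinv N"
  defines "C1 \<equiv> ctr A1 * C * ctr B1" and "A2t \<equiv> ctr A1 * A2"
    and "C2 \<equiv> ctr M * C * ctr B1" and "St \<equiv> ctr A1 * S" and "B2t \<equiv> B2 * ctr B1"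
    and "C3 \<equiv> ctr A2 * C * ctr N" and "C4 \<equiv> ctr M * C * ctr B2"
  defines "AA1 \<equiv> ctr A1 * A1" and "BB1 \<equiv> B1 * ctr B1" and "MM \<equiv> ctr M * M"
    and "AA2 \<equiv> ctr A2 * A2" and "NN \<equiv> N * ctr N" and "BB2 \<equiv> B2 * ctr B2"
    and "SS \<equiv> ctr S * S"
  (* (1) *)
  defines "dB1 \<equiv> \<lambda>j. vec n (\<lambda>k. \<Sum>\<alpha>\<in>Lki r2 r j. rdet_sub BB1 j (row C1 k) \<alpha>)"
    and "dA1 \<equiv> \<lambda>i. vec r (\<lambda>l. \<Sum>\<beta>\<in>Lki r1 n i. cdet_sub AA1 i (col C1 l) \<beta>)"
  defines "x11a \<equiv> \<lambda>i j. (\<Sum>\<beta>\<in>Lki r1 n i. cdet_sub AA1 i (dB1 j) \<beta>)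
                         / (minsum r1 AA1 * minsum r2 BB1)"
    and "x11b \<equiv> \<lambda>i j. (\<Sum>\<alpha>\<in>Lki r2 r j. rdet_sub BB1 j (dA1 i) \<alpha>)
                         / (minsum r1 AA1 * minsum r2 BB1)"
  (* (2) *)
  defines "psiB1 \<equiv> \<lambda>j. vec p (\<lambda>k. \<Sum>\<alpha>\<in>Lki r2 r j. rdet_sub BB1 j (row C2 k) \<alpha>)"
    and "psiM \<equiv> \<lambda>t. vec r (\<lambda>l. \<Sum>\<beta>\<in>Lki r5 p t. cdet_sub MM t (col C2 l) \<beta>)"
  defines "phia \<equiv> \<lambda>t j. \<Sum>\<beta>\<in>Lki r5 p t. cdet_sub MM t (psiB1 j) \<beta>"
    and "phib \<equiv> \<lambda>t j. \<Sum>\<alpha>\<in>Lki r2 r j. rdet_sub BB1 j (psiM t) \<alpha>"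
  defines "x12 \<equiv> \<lambda>i j. (\<Sum>t<p. (\<Sum>\<beta>\<in>Lki r1 n i. cdet_sub AA1 i (col A2t t) \<beta>) * phia t j)
                         / (minsum r1 AA1 * minsum r5 MM * minsum r2 BB1)"
  (* (3) *)
  defines "zetaN \<equiv> \<lambda>f. vec p (\<lambda>k. \<Sum>\<alpha>\<in>Lki r6 q f. rdet_sub NN f (row C3 k) \<alpha>)"
    and "zetaA2 \<equiv> \<lambda>t. vec q (\<lambda>l. \<Sum>\<beta>\<in>Lki r3 p t. cdet_sub AA2 t (col C3 l) \<beta>)"
  defines "etaa \<equiv> \<lambda>t f. \<Sum>\<beta>\<in>Lki r3 p t. cdet_sub AA2 t (zetaN f) \<beta>"
    and "etab \<equiv> \<lambda>t f. \<Sum>\<alpha>\<in>Lki r6 q f. rdet_sub NN f (zetaA2 t) \<alpha>"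
  defines "x13 \<equiv> \<lambda>i j. (\<Sum>t<p. \<Sum>f<q.
                (\<Sum>\<beta>\<in>Lki r1 n i. cdet_sub AA1 i (col St t) \<beta>) * etaa t f *
                (\<Sum>\<alpha>\<in>Lki r2 r j. rdet_sub BB1 j (row B2t f) \<alpha>))
             / (minsum r1 AA1 * minsum r3 AA2 * minsum r6 NN * minsum r2 BB1)"
  (* (4) *)
  defines "dB2 \<equiv> \<lambda>f. vec p (\<lambda>k. \<Sum>\<alpha>\<in>Lki r4 q f. rdet_sub BB2 f (row C4 k) \<alpha>)"
    and "dM \<equiv> \<lambda>g. vec q (\<lambda>l. \<Sum>\<beta>\<in>Lki r5 p g. cdet_sub MM g (col C4 l) \<beta>)"
  defines "x21a \<equiv> \<lambda>g f. (\<Sum>\<beta>\<in>Lki r5 p g. cdet_sub MM g (dB2 f) \<beta>)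
                         / (minsum r5 MM * minsum r4 BB2)"
    and "x21b \<equiv> \<lambda>g f. (\<Sum>\<alpha>\<in>Lki r4 q f. rdet_sub BB2 f (dM g) \<alpha>)
                         / (minsum r5 MM * minsum r4 BB2)"
  (* (5) *)
  defines "x22 \<equiv> \<lambda>g f. (\<Sum>t<p. (\<Sum>\<beta>\<in>Lki r7 p g. cdet_sub SS g (col SS t) \<beta>) * etaa t f)
                         / (minsum r7 SS * minsum r3 AA2 * minsum r6 NN)"
  shows "X1 \<in> carrier_mat n r \<and> X2 \<in> carrier_mat p q
    \<and> (\<forall>i<n. \<forall>j<r. X1 $$ (i, j) = x11a i j - x12 i j - x13 i j \<and> x11a i j = x11b i j)
    \<and> (\<forall>t<p. \<forall>j<r. phia t j = phib t j)
    \<and> (\<forall>t<p. \<forall>f<q. etaa t f = etab t f)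
    \<and> (\<forall>g<p. \<forall>f<q. X2 $$ (g, f) = x21a g f + x22 g f \<and> x21a g f = x21b g f)"
proof -
  note defs = assms(25-31) assms(18-24)
  note A1 = assms(1) and B1 = assms(2) and A2 = assms(3) and B2 = assms(4) and C = assms(5)
  note pA1 = mpinv_carrier[OF A1] and pB1 = mpinv_carrier[OF B1]
    and pA2 = mpinv_carrier[OF A2] and pB2 = mpinv_carrier[OF B2]
  have M: "M \<in> carrier_mat m p" using A1 A2 pA1 by (auto simp: assms(10) RR_def)
  have N: "N \<in> carrier_mat q s" using B1 B2 pB1 by (auto simp: assms(11) LL_def)
  note pM = mpinv_carrier[OF M] and pN = mpinv_carrier[OF N]
  have S: "S \<in> carrier_mat m p" using A2 M pM by (auto simp: assms(12) LL_def)
  note pS = mpinv_carrier[OF S]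
  note dims = carrier_matD[OF A1] carrier_matD[OF B1] carrier_matD[OF A2] carrier_matD[OF B2] carrier_matD[OF C]
    carrier_matD[OF M] carrier_matD[OF N] carrier_matD[OF S] carrier_matD[OF pA1] carrier_matD[OF pB1]
    carrier_matD[OF pA2] carrier_matD[OF pB2] carrier_matD[OF pM] carrier_matD[OF pN] carrier_matD[OF pS]
  \<comment> \<open>The denominators: minors of \<open>B1 * ctr B1\<close> are Gram minors of
    \<open>ctr B1\<close>, so the row sums appear as \<open>det_sum (ctr B1)\<close>.\<close>
  note ms = minsum_col[OF A1, unfolded assms(6)]
    minsum_row[OF B1, unfolded assms(7)]
    minsum_col[OF M, unfolded assms(13)]
    minsum_col[OF A2, unfolded assms(8)]
    minsum_row[OF N, unfolded assms(14)]
    minsum_row[OF B2, unfolded assms(9)]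
    minsum_col[OF S, unfolded assms(15)]
  \<comment> \<open>A quotient multiplies by the inverse on the right, while the scalars are
    gathered on the left; products of \<open>det_sum\<close> values are real and nonzero, so they
    cancel nevertheless.\<close>
  have divide: "det_sum U * det_sum V * z / (det_sum U * det_sum V) = z"
    "det_sum U * det_sum V * det_sum W * z / (det_sum U * det_sum V * det_sum W) = z"
    "det_sum U * det_sum V * det_sum W * det_sum Z * z / (det_sum U * det_sum V * det_sum W * det_sum Z) = z"
    for U V W Z z
    by (intro real_mult_divide real_quat_mult det_sum_real; simp add: det_sum_nonzero)+

  have X11: "x11a i j = (mpinv A1 * C * mpinv B1) $$ (i, j)" "x11b i j = (mpinv A1 * C * mpinv B1) $$ (i, j)"
    if "i < n" "j < r" for i j
    using sum_cdet_sub_rdet_sub[OF A1 B1 C that] sum_rdet_sub_cdet_sub[OF A1 B1 C that] divide(1)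
    by (simp_all add: assms(32-35) ms assms(6,7) defs(1,2,8) del: index_mult_mat(1))
  have X21: "x21a g f = (mpinv M * C * mpinv B2) $$ (g, f)" "x21b g f = (mpinv M * C * mpinv B2) $$ (g, f)"
    if "g < p" "f < q" for g f
    using sum_cdet_sub_rdet_sub[OF M B2 C that] sum_rdet_sub_cdet_sub[OF M B2 C that] divide(1)
    by (simp_all add: assms(46-49) ms assms(13,9) defs(3,6,14) del: index_mult_mat(1))
  have phi: "phia t j = det_sum M * det_sum (ctr B1) * (mpinv M * C * mpinv B1) $$ (t, j)"
    "phib t j = det_sum M * det_sum (ctr B1) * (mpinv M * C * mpinv B1) $$ (t, j)" if "t < p" "j < r" for t j
    using sum_cdet_sub_rdet_sub[OF M B1 C that] sum_rdet_sub_cdet_sub[OF M B1 C that]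
    by (simp_all add: assms(36-39) assms(13,7) defs(2,3,10) del: index_mult_mat(1))
  have eta: "etaa t f = det_sum A2 * det_sum (ctr N) * (mpinv A2 * C * mpinv N) $$ (t, f)"
    "etab t f = det_sum A2 * det_sum (ctr N) * (mpinv A2 * C * mpinv N) $$ (t, f)" if "t < p" "f < q" for t f
    using sum_cdet_sub_rdet_sub[OF A2 N C that] sum_rdet_sub_cdet_sub[OF A2 N C that]
    by (simp_all add: assms(41-44) assms(8,14) defs(4,5,13) del: index_mult_mat(1))

  have X12: "x12 i j = (mpinv A1 * A2 * mpinv M * C * mpinv B1) $$ (i, j)" if ij: "i < n" "j < r" for i j
  proof -
    \<comment> \<open>The product is cut between \<open>A2\<close> and \<open>mpinv M\<close>: the
      sum over \<open>t\<close> is matrix multiplication at this cut, with \<open>phia\<close> as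
      scaled right factor.\<close>
    have c: "mpinv M * C * mpinv B1 \<in> carrier_mat p r" using pM C pB1 by auto
    have "(\<Sum>t<p. (\<Sum>\<beta>\<in>Lki r1 n i. cdet_sub AA1 i (col A2t t) \<beta>) * phia t j) =
        (\<Sum>t<p. det_sum A1 * (mpinv A1 * A2) $$ (i, t) *
          (det_sum M * det_sum (ctr B1) * (mpinv M * C * mpinv B1) $$ (t, j)))"
      using ij sum_cdet_sub_col[OF A1 A2 ij(1)]
      by (intro sum.cong refl) (simp add: phi assms(6) defs(1,9) del: index_mult_mat(1))
    also have "\<dots> = det_sum A1 * det_sum M * det_sum (ctr B1) * (mpinv A1 * A2 * (mpinv M * C * mpinv B1)) $$ (i, j)"
      unfolding index_mult_mat_sum[OF mult_carrier_mat[OF pA1 A2] c ij] sum_distrib_left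
      by (intro sum.cong refl real_quat_rearrange det_sum_real)
    finally have "x12 i j = (mpinv A1 * A2 * (mpinv M * C * mpinv B1)) $$ (i, j)"
      unfolding assms(40) ms[folded defs(1-7)] by (simp only: divide(2))
    then show ?thesis by (simp add: assoc_mult_dim dims del: index_mult_mat(1))
  qed

  have X13: "x13 i j = (mpinv A1 * S * mpinv A2 * C * mpinv N * B2 * mpinv B1) $$ (i, j)"
    if ij: "i < n" "j < r" for i j
  proof -
    \<comment> \<open>Two cuts, one for each summation index: \<open>t\<close> runs between
      \<open>S\<close> and \<open>mpinv A2\<close>, and \<open>f\<close> between
      \<open>mpinv N\<close> and \<open>B2\<close>.\<close>
    let ?U = "mpinv A1 * S" and ?V = "mpinv A2 * C * mpinv N" and ?W = "B2 * mpinv B1"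
    have c: "?U \<in> carrier_mat n p" "?V \<in> carrier_mat p q" "?W \<in> carrier_mat q r"
      using pA1 S pA2 C pN B2 pB1 by auto
    have "(\<Sum>t<p. \<Sum>f<q. (\<Sum>\<beta>\<in>Lki r1 n i. cdet_sub AA1 i (col St t) \<beta>) * etaa t f *
                (\<Sum>\<alpha>\<in>Lki r2 r j. rdet_sub BB1 j (row B2t f) \<alpha>)) =
        (\<Sum>t<p. \<Sum>f<q. det_sum A1 * ?U $$ (i, t) * (det_sum A2 * det_sum (ctr N) * ?V $$ (t, f)) *
          (det_sum (ctr B1) * ?W $$ (f, j)))"
      using ij sum_cdet_sub_col[OF A1 S ij(1)] sum_rdet_sub_row[OF B1 B2 _ ij(2)]
      by (intro sum.cong refl) (simp add: eta assms(6,7) defs(1,2,11,12) del: index_mult_mat(1))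
    also have "\<dots> = det_sum A1 * det_sum A2 * det_sum (ctr N) * det_sum (ctr B1) *
        (\<Sum>t<p. ?U $$ (i, t) * (\<Sum>f<q. ?V $$ (t, f) * ?W $$ (f, j)))"
      unfolding sum_distrib_left by (intro sum.cong refl real_quat_rearrange4 det_sum_real)
    also have "(\<Sum>t<p. ?U $$ (i, t) * (\<Sum>f<q. ?V $$ (t, f) * ?W $$ (f, j))) = (?U * (?V * ?W)) $$ (i, j)"
      unfolding index_mult_mat_sum[OF c(1) mult_carrier_mat[OF c(2,3)] ij]
      by (intro sum.cong refl) (simp add: index_mult_mat_sum[OF c(2,3) _ ij(2)] del: index_mult_mat(1))
    finally have "x13 i j = (?U * (?V * ?W)) $$ (i, j)"
      unfolding assms(45) ms[folded defs(1-7)] by (simp only: divide(3))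
    then show ?thesis by (simp add: assoc_mult_dim dims del: index_mult_mat(1))
  qed

  have X22: "x22 g f = (PP S * mpinv A2 * C * mpinv N) $$ (g, f)" if gf: "g < p" "f < q" for g f
  proof -
    have c: "mpinv A2 * C * mpinv N \<in> carrier_mat p q" using pA2 C pN by auto
    have "(\<Sum>t<p. (\<Sum>\<beta>\<in>Lki r7 p g. cdet_sub SS g (col SS t) \<beta>) * etaa t f) =
        (\<Sum>t<p. det_sum S * (mpinv S * S) $$ (g, t) *
          (det_sum A2 * det_sum (ctr N) * (mpinv A2 * C * mpinv N) $$ (t, f)))"
      \<comment> \<open>Taking \<open>S\<close> itself as right factor produces the projection
        \<open>mpinv S * S\<close>, since the inserted columns are those of
        \<open>ctr S * S\<close>.\<close>
      using gf sum_cdet_sub_col[OF S S gf(1)]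
      by (intro sum.cong refl) (simp add: eta assms(15) defs(7) del: index_mult_mat(1))
    also have "\<dots> = det_sum S * det_sum A2 * det_sum (ctr N) * (mpinv S * S * (mpinv A2 * C * mpinv N)) $$ (g, f)"
      unfolding index_mult_mat_sum[OF mult_carrier_mat[OF pS S] c gf] sum_distrib_left
      by (intro sum.cong refl real_quat_rearrange det_sum_real)
    finally have "x22 g f = (mpinv S * S * (mpinv A2 * C * mpinv N)) $$ (g, f)"
      unfolding assms(50) ms[folded defs(1-7)] by (simp only: divide(2))
    then show ?thesis by (simp add: assoc_mult_dim dims PP_def del: index_mult_mat(1))
  qed

  have carrier: "X1 \<in> carrier_mat n r" "X2 \<in> carrier_mat p q"
    by (rule carrier_matI; simp add: assms(16,17) PP_def dims)+
  moreover have "X1 $$ (i, j) = x11a i j - x12 i j - x13 i j" if "i < n" "j < r" for i j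
    unfolding assms(16) X11[OF that] X12[OF that] X13[OF that]
    using that by (simp add: dims del: index_mult_mat(1))
  moreover have "X2 $$ (g, f) = x21a g f + x22 g f" if "g < p" "f < q" for g f
    unfolding assms(17) X21[OF that] X22[OF that]
    using that by (simp add: dims PP_def del: index_mult_mat(1))
  ultimately show ?thesis
    using X11 X21 phi eta by simp
qed

end
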